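(* Let $Q$ be a finite-dimensional real vector space, $\Delta t,\Delta x>0$, and fix quadrature rules with nodes $c_i\in[0,1]$ and weights $b_i\ne0$, $\sum_ib_i=1$ ($i=1,\dots,s$) in time, and nodes $\tilde c_\alpha\in[0,1]$ and weights $\tilde b_\alpha\neq0$, $\sum_\alpha\tilde b_\alpha=1$ ($\alpha=1,\dots,\sigma$) in space. Let $H_d^+=H_d^+(\{\varphi_{[j]0},\varphi_{0[\beta]},\pi^1_{[j]1},\pi^0_{1[\beta]}\}_{j,\beta})$ be the (smooth) associated discrete boundary Hamiltonian on $\Box=[0,\Delta t]\times[0,\Delta x]$. (1) The discrete forward Hamilton's equations arising from the Type II variational principle are $$\pi^1_{[i]0}=\frac{1}{b_i\Delta t}D_{1,i}H_d^+(\{\varphi_{[j]0},\varphi_{0[\beta]},\pi^1_{[j]1},\pi^0_{1[\beta]}\}_{j,\beta}),\qquad i=1,\dots,s,$$ $$\pi^0_{0[\alpha]}=\frac{1}{\tilde b_\alpha\Delta x}D_{2,\alpha}H_d^+(\{\varphi_{[j]0},\varphi_{0[\beta]},\pi^1_{[j]1},\pi^0_{1[\beta]}\}_{j,\beta}),\qquad \alpha=1,\dots,\sigma,$$ $$\varphi_{[i]1}=\frac{1}{b_i\Delta t}D_{3,i}H_d^+(\{\varphi_{[j]0},\varphi_{0[\beta]},\pi^1_{[j]1},\pi^0_{1[\beta]}\}_{j,\beta}),\qquad i=1,\dots,s,$$ $$\varphi_{1[\alpha]}=\frac{1}{\tilde b_\alpha\Delta x}D_{4,\alpha}H_d^+(\{\varphi_{[j]0},\varphi_{0[\beta]},\pi^1_{[j]1},\pi^0_{1[\beta]}\}_{j,\beta}),\qquad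 \alpha=1,\dots,\sigma,$$ where $D_{1,i}=\partial/\partial\varphi_{[i]0}$, $D_{2,\alpha}=\partial/\partial\varphi_{0[\alpha]}$, $D_{3,i}=\partial/\partial\pi^1_{[i]1}$, $D_{4,\alpha}=\partial/\partial\pi^0_{1[\alpha]}$. (2) A solution of the discrete forward Hamilton's equations satisfies the discrete multisymplectic conservation law $$\sum_{i=1}^s\Delta t\,b_i\Big(d\varphi_{[i]1}\wedge d\pi^1_{[i]1}-d\varphi_{[i]0}\wedge d\pi^1_{[i]0}\Big)+\sum_{\alpha=1}^\sigma\Delta x\,\tilde b_\alpha\Big(d\varphi_{1[\alpha]}\wedge d\pi^0_{1[\alpha]}-d\varphi_{0[\alpha]}\wedge d\pi^0_{0[\alpha]}\Big)=0,$$ evaluated on discrete first variations.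
   Context: Boundary values on an element $\Box=[0,\Delta t]\times[0,\Delta x]$: $\varphi_{[i]0},\varphi_{[i]1}\in Q$ are the field values at $(c_i\Delta t,0)$ and $(c_i\Delta t,\Delta x)$, with normal momenta ($x$ direction) $\pi^1_{[i]0},\pi^1_{[i]1}\in Q^*$; $\varphi_{0[\alpha]},\varphi_{1[\alpha]}\in Q$ are the field values at $(0,\tilde c_\alpha\Delta x)$ and $(\Delta t,\tilde c_\alpha\Delta x)$, with normal momenta ($t$ direction) $\pi^0_{0[\alpha]},\pi^0_{1[\alpha]}\in Q^*$. All are treated as independent variables. $\pi\varphi$ denotes the duality pairing, and $d\varphi\wedge d\pi=\sum_Ad\varphi^A\wedge d\pi_A$ in dual linear coordinates. Discrete boundary Hamiltonian: $$H_d^+(\{\varphi_{[i]0},\varphi_{0[\alpha]},\pi^1_{[i]1},\pi^0_{1[\alpha]}\}_{i,\alpha})=\operatorname{ext}\Big(\sum_{i}\Delta t\,b_i\pi^1_{[i]1}\varphi_{[i]1}+\sum_{\alpha}\Delta x\,\tilde b_\alpha\pi^0_{1[\alpha]}\varphi_{1[\alpha]}-S_d^{\Box}[\phi,p]\Big),$$ the extremal (stationary) value over discrete fields and momenta on $\Box$ with the prescribed boundary values, where $S_d^\Box$ is some discrete approximation of the action. For this result only its being a smooth function of its arguments matters. Type II variational principle: consider $X=[t_0,t_0+N\Delta t]\times[x_0,x_0+M\Delta x]$ with the mesh of elements $\Box_{ab}=[t_0+a\Delta t,t_0+(a+1)\Delta t]\times[x_0+b\Delta x,x_0+(b+1)\Delta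 x]$, $0\le a\le N-1$, $0\le b\le M-1$. Each $\Box_{ab}$, translated to $[0,\Delta t]\times[0,\Delta x]$, carries field boundary values $\varphi_{[i]0},\varphi_{[i]1}$ at $(c_i\Delta t,0)$ and $(c_i\Delta t,\Delta x)$ with normal momenta $\pi^1_{[i]0},\pi^1_{[i]1}$ ($i=1,\dots,s$), and field boundary values $\varphi_{0[\alpha]},\varphi_{1[\alpha]}$ at $(0,\tilde c_\alpha\Delta x)$ and $(\Delta t,\tilde c_\alpha\Delta x)$ with normal momenta $\pi^0_{0[\alpha]},\pi^0_{1[\alpha]}$ ($\alpha=1,\dots,\sigma$) (with extra superscript $(a,b)$), where values on a shared edge are identified: the index-$1$ values on the edge $x=x_0+(b+1)\Delta x$ of $\Box_{ab}$ are the index-$0$ values of $\Box_{a,b+1}$, and the index-$1$ values on the edge $t=t_0+(a+1)\Delta t$ of $\Box_{ab}$ are the index-$0$ values of $\Box_{a+1,b}$. The discrete action sum is $$S_d=\sum_{a}\sum_i\Delta t\,b_i(\pi^1_{[i]1}\varphi_{[i]1})^{(a,M-1)}+\sum_b\sum_\alpha\Delta x\,\tilde b_\alpha(\pi^0_{1[\alpha]}\varphi_{1[\alpha]})^{(N-1,b)}-\sum_{a,b}\Big[\sum_i\Delta t\,b_i\pi^1_{[i]1}\varphi_{[i]1}+\sum_\alpha\Delta x\,\tilde b_\alpha\pi^0_{1[\alpha]}\varphi_{1[\alpha]}-H_d^+\Big]^{(a,b)}.$$ The principle is $\delta S_d=0$ for independent variations subject to variations of $\varphi$ vanishing along $A(X)$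 (the edges $t=t_0$ and $x=x_0$ of $X$) and variations of $\pi$ vanishing along $B(X)$ (the edges $t=t_0+N\Delta t$ and $x=x_0+M\Delta x$ of $X$). The equations in (1) are the resulting equations on each $\Box_{ab}$ (superscript $(a,b)$ suppressed): those for $\pi$ on edges not in $A(X)$ and for $\varphi$ on edges not in $B(X)$ are consequences of the principle; the $\pi$ on $A(X)$ and $\varphi$ on $B(X)$ do not effectively enter $S_d$ and are defined by the same formulas. A discrete first variation at a solution on $\Box$ is a vector $V$ tangent to the space of all boundary values $(\varphi_{[i]0},\varphi_{[i]1},\varphi_{0[\alpha]},\varphi_{1[\alpha]},\pi^1_{[i]0},\pi^1_{[i]1},\pi^0_{0[\alpha]},\pi^0_{1[\alpha]})_{i,\alpha}$ for which the discrete forward Hamilton's equations hold at the level of the exterior derivative, e.g. $d\pi^1_{[i]0}(V)=\frac{1}{b_i\Delta t}d(D_{1,i}H_d^+)(V)$, and similarly for the other three families. *)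

theory Defs
  imports "HOL-Analysis.Analysis"
begin

text \<open>
  \<open>'q\<close> is the space \<open>Q\<close>, \<open>'q dual\<close> its dual, and the finite index types \<open>'s\<close>, \<open>'r\<close> are
  the ranges of the quadrature indices \<open>i = 1,...,s\<close> (time) and \<open>\<alpha> = 1,...,\<sigma>\<close> (space).
  That \<open>Q\<close> is finite-dimensional is not part of the type: it is expressed by a finite basis where
  needed. The norm of \<open>Q\<close> is then immaterial, and every linear functional is bounded.
\<close>

type_synonym 'q dual = "'q \<Rightarrow>\<^sub>L real"

text \<open>
  The arguments of the boundary Hamiltonian, in the order
  \<open>\<phi>\<^bsub>[i]0\<^esub>\<close>, \<open>\<phi>\<^bsub>0[\<alpha>]\<^esub>\<close>, \<open>\<pi>\<^sup>1\<^bsub>[i]1\<^esub>\<close>, \<open>\<pi>\<^sup>0\<^bsub>1[\<alpha>]\<^esub>\<close>.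
\<close>

type_synonym ('q, 's, 'r) ham_arg =
  "('q ^ 's) \<times> ('q ^ 'r) \<times> ('q dual ^ 's) \<times> ('q dual ^ 'r)"

text \<open>
  All boundary values on an element, in the order \<open>\<phi>\<^bsub>[i]0\<^esub>\<close>, \<open>\<phi>\<^bsub>[i]1\<^esub>\<close>, \<open>\<phi>\<^bsub>0[\<alpha>]\<^esub>\<close>, \<open>\<phi>\<^bsub>1[\<alpha>]\<^esub>\<close>,
  \<open>\<pi>\<^sup>1\<^bsub>[i]0\<^esub>\<close>, \<open>\<pi>\<^sup>1\<^bsub>[i]1\<^esub>\<close>, \<open>\<pi>\<^sup>0\<^bsub>0[\<alpha>]\<^esub>\<close>, \<open>\<pi>\<^sup>0\<^bsub>1[\<alpha>]\<^esub>\<close>. In the names of the projections below, \<open>x0\<close>, \<open>x1\<close> refer to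
  the two edges of constant \<open>x\<close> and \<open>t0\<close>, \<open>t1\<close> to the two edges of constant \<open>t\<close>, so that
  \<open>mom_x\<close> is \<open>\<pi>\<^sup>1\<close> and \<open>mom_t\<close> is \<open>\<pi>\<^sup>0\<close>.
\<close>

type_synonym ('q, 's, 'r) bdry =
  "('q ^ 's) \<times> ('q ^ 's) \<times> ('q ^ 'r) \<times> ('q ^ 'r) \<times>
   ('q dual ^ 's) \<times> ('q dual ^ 's) \<times> ('q dual ^ 'r) \<times> ('q dual ^ 'r)"

definition phi_x0 :: "('q::real_normed_vector, 's::finite, 'r::finite) bdry \<Rightarrow> 'q ^ 's"
  where "phi_x0 = (\<lambda>(fx0, fx1, ft0, ft1, mx0, mx1, mt0, mt1). fx0)"

definition phi_x1 :: "('q::real_normed_vector, 's::finite, 'r::finite) bdry \<Rightarrow> 'q ^ 's"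
  where "phi_x1 = (\<lambda>(fx0, fx1, ft0, ft1, mx0, mx1, mt0, mt1). fx1)"

definition phi_t0 :: "('q::real_normed_vector, 's::finite, 'r::finite) bdry \<Rightarrow> 'q ^ 'r"
  where "phi_t0 = (\<lambda>(fx0, fx1, ft0, ft1, mx0, mx1, mt0, mt1). ft0)"

definition phi_t1 :: "('q::real_normed_vector, 's::finite, 'r::finite) bdry \<Rightarrow> 'q ^ 'r"
  where "phi_t1 = (\<lambda>(fx0, fx1, ft0, ft1, mx0, mx1, mt0, mt1). ft1)"

definition mom_x0 :: "('q::real_normed_vector, 's::finite, 'r::finite) bdry \<Rightarrow> 'q dual ^ 's"
  where "mom_x0 = (\<lambda>(fx0, fx1, ft0, ft1, mx0, mx1, mt0, mt1). mx0)"

definition mom_x1 :: "('q::real_normed_vector, 's::finite, 'r::finite) bdry \<Rightarrow> 'q dual ^ 's"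
  where "mom_x1 = (\<lambda>(fx0, fx1, ft0, ft1, mx0, mx1, mt0, mt1). mx1)"

definition mom_t0 :: "('q::real_normed_vector, 's::finite, 'r::finite) bdry \<Rightarrow> 'q dual ^ 'r"
  where "mom_t0 = (\<lambda>(fx0, fx1, ft0, ft1, mx0, mx1, mt0, mt1). mt0)"

definition mom_t1 :: "('q::real_normed_vector, 's::finite, 'r::finite) bdry \<Rightarrow> 'q dual ^ 'r"
  where "mom_t1 = (\<lambda>(fx0, fx1, ft0, ft1, mx0, mx1, mt0, mt1). mt1)"

definition ham_args ::
  "('q::real_normed_vector, 's::finite, 'r::finite) bdry \<Rightarrow> ('q, 's, 'r) ham_arg"
  where "ham_args z = (phi_x0 z, phi_t0 z, mom_x1 z, mom_t1 z)"


definition quadrature_rule :: "('i::finite \<Rightarrow> real) \<Rightarrow> ('i \<Rightarrow> real) \<Rightarrow> bool"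
  where "quadrature_rule c b \<longleftrightarrow> (\<forall>i. c i \<in> {0..1}) \<and> (\<forall>i. b i \<noteq> 0) \<and> (\<Sum>i\<in>UNIV. b i) = 1"

text \<open>
  \<open>C\<^sup>k\<close> and \<open>C\<^sup>\<infinity>\<close> on the whole space. The higher derivatives are taken one direction at a time,
  which keeps the type fixed; on a finite-dimensional domain this is the usual notion.
\<close>

primrec C_diff :: "nat \<Rightarrow> ('a::real_normed_vector \<Rightarrow> 'b::real_normed_vector) \<Rightarrow> bool"
  where
    "C_diff 0 f \<longleftrightarrow> continuous_on UNIV f"
  | "C_diff (Suc k) f \<longleftrightarrow>
       (\<forall>x. f differentiable (at x)) \<and> (\<forall>v. C_diff k (\<lambda>x. frechet_derivative f (at x) v))"

definition smooth :: "('a::real_normed_vector \<Rightarrow> 'b::real_normed_vector) \<Rightarrow> bool"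
  where "smooth f \<longleftrightarrow> (\<forall>k. C_diff k f)"


text \<open>
  A derivative with respect to a variable in \<open>Q\<close> is an element of \<open>Q\<^sup>*\<close>. A
  derivative with respect to a variable in \<open>Q\<^sup>*\<close> is an element of the bidual, which
  \<open>of_bidual\<close> identifies with \<open>Q\<close> in the canonical way.
\<close>

definition vec_upd :: "'a ^ 'i \<Rightarrow> 'i::finite \<Rightarrow> 'a \<Rightarrow> 'a ^ 'i"
  where "vec_upd u i y = (\<chi> j. if j = i then y else u $ j)"

definition of_bidual :: "('q::real_normed_vector dual \<Rightarrow> real) \<Rightarrow> 'q"
  where "of_bidual L = (THE q. \<forall>p. L p = blinfun_apply p q)"

definition D1 :: "(('q::real_normed_vector, 's::finite, 'r::finite) ham_arg \<Rightarrow> real) \<Rightarrow>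
    's \<Rightarrow> ('q, 's, 'r) ham_arg \<Rightarrow> 'q dual"
  where "D1 H i = (\<lambda>(fx, ft, mx, mt).
    Blinfun (frechet_derivative (\<lambda>y. H (vec_upd fx i y, ft, mx, mt)) (at (fx $ i))))"

definition D2 :: "(('q::real_normed_vector, 's::finite, 'r::finite) ham_arg \<Rightarrow> real) \<Rightarrow>
    'r \<Rightarrow> ('q, 's, 'r) ham_arg \<Rightarrow> 'q dual"
  where "D2 H \<alpha> = (\<lambda>(fx, ft, mx, mt).
    Blinfun (frechet_derivative (\<lambda>y. H (fx, vec_upd ft \<alpha> y, mx, mt)) (at (ft $ \<alpha>))))"

definition D3 :: "(('q::real_normed_vector, 's::finite, 'r::finite) ham_arg \<Rightarrow> real) \<Rightarrow>
    's \<Rightarrow> ('q, 's, 'r) ham_arg \<Rightarrow> 'q"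
  where "D3 H i = (\<lambda>(fx, ft, mx, mt).
    of_bidual (frechet_derivative (\<lambda>y. H (fx, ft, vec_upd mx i y, mt)) (at (mx $ i))))"

definition D4 :: "(('q::real_normed_vector, 's::finite, 'r::finite) ham_arg \<Rightarrow> real) \<Rightarrow>
    'r \<Rightarrow> ('q, 's, 'r) ham_arg \<Rightarrow> 'q"
  where "D4 H \<alpha> = (\<lambda>(fx, ft, mx, mt).
    of_bidual (frechet_derivative (\<lambda>y. H (fx, ft, mx, vec_upd mt \<alpha> y)) (at (mt $ \<alpha>))))"


definition eq_mom_x0 :: "real \<Rightarrow> ('s \<Rightarrow> real) \<Rightarrow>
    (('q::real_normed_vector, 's::finite, 'r::finite) ham_arg \<Rightarrow> real) \<Rightarrow> ('q, 's, 'r) bdry \<Rightarrow> bool"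
  where "eq_mom_x0 dt b H z \<longleftrightarrow>
    (\<forall>i. mom_x0 z $ i = (1 / (b i * dt)) *\<^sub>R D1 H i (ham_args z))"

definition eq_mom_t0 :: "real \<Rightarrow> ('r \<Rightarrow> real) \<Rightarrow>
    (('q::real_normed_vector, 's::finite, 'r::finite) ham_arg \<Rightarrow> real) \<Rightarrow> ('q, 's, 'r) bdry \<Rightarrow> bool"
  where "eq_mom_t0 dx b' H z \<longleftrightarrow>
    (\<forall>\<alpha>. mom_t0 z $ \<alpha> = (1 / (b' \<alpha> * dx)) *\<^sub>R D2 H \<alpha> (ham_args z))"

definition eq_phi_x1 :: "real \<Rightarrow> ('s \<Rightarrow> real) \<Rightarrow>
    (('q::real_normed_vector, 's::finite, 'r::finite) ham_arg \<Rightarrow> real) \<Rightarrow> ('q, 's, 'r) bdry \<Rightarrow> bool"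
  where "eq_phi_x1 dt b H z \<longleftrightarrow>
    (\<forall>i. phi_x1 z $ i = (1 / (b i * dt)) *\<^sub>R D3 H i (ham_args z))"

definition eq_phi_t1 :: "real \<Rightarrow> ('r \<Rightarrow> real) \<Rightarrow>
    (('q::real_normed_vector, 's::finite, 'r::finite) ham_arg \<Rightarrow> real) \<Rightarrow> ('q, 's, 'r) bdry \<Rightarrow> bool"
  where "eq_phi_t1 dx b' H z \<longleftrightarrow>
    (\<forall>\<alpha>. phi_t1 z $ \<alpha> = (1 / (b' \<alpha> * dx)) *\<^sub>R D4 H \<alpha> (ham_args z))"

definition forward_hamilton :: "real \<Rightarrow> real \<Rightarrow> ('s \<Rightarrow> real) \<Rightarrow> ('r \<Rightarrow> real) \<Rightarrow>
    (('q::real_normed_vector, 's::finite, 'r::finite) ham_arg \<Rightarrow> real) \<Rightarrow> ('q, 's, 'r) bdry \<Rightarrow> bool"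
  where "forward_hamilton dt dx b b' H z \<longleftrightarrow>
    eq_mom_x0 dt b H z \<and> eq_mom_t0 dx b' H z \<and> eq_phi_x1 dt b H z \<and> eq_phi_t1 dx b' H z"


text \<open>
  Values on the mesh of elements \<open>(m, n)\<close>, \<open>m < N\<close>, \<open>n < M\<close>, where \<open>m\<close> counts in the \<open>t\<close>
  direction and \<open>n\<close> in the \<open>x\<close> direction. Every element carries its own boundary values;
  \<open>shared_edges\<close> identifies the values on common edges. The edges in \<open>A(X)\<close> are the \<open>x0\<close>-edges of the
  elements \<open>(m, 0)\<close> and the \<open>t0\<close>-edges of the elements \<open>(0, n)\<close>; those in \<open>B(X)\<close> are the \<open>x1\<close>-edges
  of the elements \<open>(m, M - 1)\<close> and the \<open>t1\<close>-edges of the elements \<open>(N - 1, n)\<close>.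
\<close>

type_synonym ('q, 's, 'r) mesh_values = "nat \<Rightarrow> nat \<Rightarrow> ('q, 's, 'r) bdry"

definition shared_edges ::
  "nat \<Rightarrow> nat \<Rightarrow> ('q::real_normed_vector, 's::finite, 'r::finite) mesh_values \<Rightarrow> bool"
  where "shared_edges N M Z \<longleftrightarrow>
    (\<forall>m n. m < N \<and> n + 1 < M \<longrightarrow>
       phi_x1 (Z m n) = phi_x0 (Z m (n + 1)) \<and> mom_x1 (Z m n) = mom_x0 (Z m (n + 1))) \<and>
    (\<forall>m n. m + 1 < N \<and> n < M \<longrightarrow>
       phi_t1 (Z m n) = phi_t0 (Z (m + 1) n) \<and> mom_t1 (Z m n) = mom_t0 (Z (m + 1) n))"

definition admissible_variation ::
  "nat \<Rightarrow> nat \<Rightarrow> ('q::real_normed_vector, 's::finite, 'r::finite) mesh_values \<Rightarrow> bool"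
  where "admissible_variation N M \<delta> \<longleftrightarrow>
    shared_edges N M \<delta> \<and>
    (\<forall>m<N. phi_x0 (\<delta> m 0) = 0) \<and> (\<forall>n<M. phi_t0 (\<delta> 0 n) = 0) \<and>
    (\<forall>m<N. mom_x1 (\<delta> m (M - 1)) = 0) \<and> (\<forall>n<M. mom_t1 (\<delta> (N - 1) n) = 0)"

definition action_sum :: "real \<Rightarrow> real \<Rightarrow> ('s \<Rightarrow> real) \<Rightarrow> ('r \<Rightarrow> real) \<Rightarrow>
    (('q::real_normed_vector, 's::finite, 'r::finite) ham_arg \<Rightarrow> real) \<Rightarrow>
    nat \<Rightarrow> nat \<Rightarrow> ('q, 's, 'r) mesh_values \<Rightarrow> real"
  where "action_sum dt dx b b' H N M Z =
    (\<Sum>m<N. \<Sum>i\<in>UNIV. dt * b i *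
       blinfun_apply (mom_x1 (Z m (M - 1)) $ i) (phi_x1 (Z m (M - 1)) $ i)) +
    (\<Sum>n<M. \<Sum>\<alpha>\<in>UNIV. dx * b' \<alpha> *
       blinfun_apply (mom_t1 (Z (N - 1) n) $ \<alpha>) (phi_t1 (Z (N - 1) n) $ \<alpha>)) -
    (\<Sum>m<N. \<Sum>n<M.
       (\<Sum>i\<in>UNIV. dt * b i * blinfun_apply (mom_x1 (Z m n) $ i) (phi_x1 (Z m n) $ i)) +
       (\<Sum>\<alpha>\<in>UNIV. dx * b' \<alpha> * blinfun_apply (mom_t1 (Z m n) $ \<alpha>) (phi_t1 (Z m n) $ \<alpha>)) -
       H (ham_args (Z m n)))"

definition type_II_stationary :: "real \<Rightarrow> real \<Rightarrow> ('s \<Rightarrow> real) \<Rightarrow> ('r \<Rightarrow> real) \<Rightarrow>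
    (('q::real_normed_vector, 's::finite, 'r::finite) ham_arg \<Rightarrow> real) \<Rightarrow>
    nat \<Rightarrow> nat \<Rightarrow> ('q, 's, 'r) mesh_values \<Rightarrow> bool"
  where "type_II_stationary dt dx b b' H N M Z \<longleftrightarrow>
    (\<forall>\<delta>. admissible_variation N M \<delta> \<longrightarrow>
      ((\<lambda>\<epsilon>. action_sum dt dx b b' H N M (\<lambda>m n. Z m n + \<epsilon> *\<^sub>R \<delta> m n)) has_real_derivative 0) (at 0))"

text \<open>
  The equations for \<open>\<pi>\<close> on edges not in \<open>A(X)\<close> and for \<open>\<phi>\<close> on edges not in \<open>B(X)\<close>, and the remaining
  ones, which define \<open>\<pi>\<close> on \<open>A(X)\<close> and \<open>\<phi>\<close> on \<open>B(X)\<close>.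
\<close>

definition interior_equations :: "real \<Rightarrow> real \<Rightarrow> ('s \<Rightarrow> real) \<Rightarrow> ('r \<Rightarrow> real) \<Rightarrow>
    (('q::real_normed_vector, 's::finite, 'r::finite) ham_arg \<Rightarrow> real) \<Rightarrow>
    nat \<Rightarrow> nat \<Rightarrow> ('q, 's, 'r) mesh_values \<Rightarrow> bool"
  where "interior_equations dt dx b b' H N M Z \<longleftrightarrow>
    (\<forall>m<N. \<forall>n<M.
       (n \<noteq> 0 \<longrightarrow> eq_mom_x0 dt b H (Z m n)) \<and>
       (m \<noteq> 0 \<longrightarrow> eq_mom_t0 dx b' H (Z m n)) \<and>
       (n \<noteq> M - 1 \<longrightarrow> eq_phi_x1 dt b H (Z m n)) \<and>
       (m \<noteq> N - 1 \<longrightarrow> eq_phi_t1 dx b' H (Z m n)))"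

definition boundary_equations :: "real \<Rightarrow> real \<Rightarrow> ('s \<Rightarrow> real) \<Rightarrow> ('r \<Rightarrow> real) \<Rightarrow>
    (('q::real_normed_vector, 's::finite, 'r::finite) ham_arg \<Rightarrow> real) \<Rightarrow>
    nat \<Rightarrow> nat \<Rightarrow> ('q, 's, 'r) mesh_values \<Rightarrow> bool"
  where "boundary_equations dt dx b b' H N M Z \<longleftrightarrow>
    (\<forall>m<N. eq_mom_x0 dt b H (Z m 0)) \<and>
    (\<forall>n<M. eq_mom_t0 dx b' H (Z 0 n)) \<and>
    (\<forall>m<N. eq_phi_x1 dt b H (Z m (M - 1))) \<and>
    (\<forall>n<M. eq_phi_t1 dx b' H (Z (N - 1) n))"


text \<open>
  Exterior derivatives at \<open>z\<close> on the (linear) space of boundary values, whose tangent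
  vectors are again boundary values.
\<close>

abbreviation ext_d :: "('a::real_normed_vector \<Rightarrow> 'b::real_normed_vector) \<Rightarrow> 'a \<Rightarrow> 'a \<Rightarrow> 'b"
  where "ext_d f z V \<equiv> frechet_derivative f (at z) V"

definition first_variation :: "real \<Rightarrow> real \<Rightarrow> ('s \<Rightarrow> real) \<Rightarrow> ('r \<Rightarrow> real) \<Rightarrow>
    (('q::real_normed_vector, 's::finite, 'r::finite) ham_arg \<Rightarrow> real) \<Rightarrow>
    ('q, 's, 'r) bdry \<Rightarrow> ('q, 's, 'r) bdry \<Rightarrow> bool"
  where "first_variation dt dx b b' H z V \<longleftrightarrow>
    (\<forall>i. ext_d (\<lambda>w. mom_x0 w $ i) z V =
       (1 / (b i * dt)) *\<^sub>R ext_d (\<lambda>w. D1 H i (ham_args w)) z V) \<and>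
    (\<forall>\<alpha>. ext_d (\<lambda>w. mom_t0 w $ \<alpha>) z V =
       (1 / (b' \<alpha> * dx)) *\<^sub>R ext_d (\<lambda>w. D2 H \<alpha> (ham_args w)) z V) \<and>
    (\<forall>i. ext_d (\<lambda>w. phi_x1 w $ i) z V =
       (1 / (b i * dt)) *\<^sub>R ext_d (\<lambda>w. D3 H i (ham_args w)) z V) \<and>
    (\<forall>\<alpha>. ext_d (\<lambda>w. phi_t1 w $ \<alpha>) z V =
       (1 / (b' \<alpha> * dx)) *\<^sub>R ext_d (\<lambda>w. D4 H \<alpha> (ham_args w)) z V)"

definition wedge :: "('a \<Rightarrow> real) \<Rightarrow> ('a \<Rightarrow> real) \<Rightarrow> 'a \<Rightarrow> 'a \<Rightarrow> real"
  where "wedge \<omega> \<eta> V W = \<omega> V * \<eta> W - \<omega> W * \<eta> V"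

text \<open>
  \<open>d\<phi> \<and> d\<pi> = \<Sum>\<^sub>A d\<phi>\<^sup>A \<and> d\<pi>\<^sub>A\<close> at \<open>z\<close>, for a \<open>Q\<close>-valued function \<open>f\<close> and a \<open>Q\<^sup>*\<close>-valued function \<open>g\<close>, in the
  linear coordinates of the basis \<open>B\<close> of \<open>Q\<close> and the dual coordinates: \<open>\<phi>\<^sup>A\<close> is the coefficient of
  the basis vector \<open>A\<close>, and \<open>\<pi>\<^sub>A\<close> is the value of \<open>\<pi>\<close> at \<open>A\<close>.
\<close>

definition dphi_wedge_dpi :: "'q::real_normed_vector set \<Rightarrow> ('a::real_normed_vector \<Rightarrow> 'q) \<Rightarrow>
    ('a \<Rightarrow> 'q dual) \<Rightarrow> 'a \<Rightarrow> 'a \<Rightarrow> 'a \<Rightarrow> real"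
  where "dphi_wedge_dpi B f g z V W =
    (\<Sum>A\<in>B. wedge (ext_d (\<lambda>w. representation B (f w) A) z)
                   (ext_d (\<lambda>w. blinfun_apply (g w) A) z) V W)"

definition multisymplectic_form :: "'q::real_normed_vector set \<Rightarrow> real \<Rightarrow> real \<Rightarrow>
    ('s::finite \<Rightarrow> real) \<Rightarrow> ('r::finite \<Rightarrow> real) \<Rightarrow>
    ('q, 's, 'r) bdry \<Rightarrow> ('q, 's, 'r) bdry \<Rightarrow> ('q, 's, 'r) bdry \<Rightarrow> real"
  where "multisymplectic_form B dt dx b b' z V W =
    (\<Sum>i\<in>UNIV. dt * b i *
       (dphi_wedge_dpi B (\<lambda>w. phi_x1 w $ i) (\<lambda>w. mom_x1 w $ i) z V W -
        dphi_wedge_dpi B (\<lambda>w. phi_x0 w $ i) (\<lambda>w. mom_x0 w $ i) z V W)) +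
    (\<Sum>\<alpha>\<in>UNIV. dx * b' \<alpha> *
       (dphi_wedge_dpi B (\<lambda>w. phi_t1 w $ \<alpha>) (\<lambda>w. mom_t1 w $ \<alpha>) z V W -
        dphi_wedge_dpi B (\<lambda>w. phi_t0 w $ \<alpha>) (\<lambda>w. mom_t0 w $ \<alpha>) z V W))"

end

theory Submission
  imports Defs
begin

text \<open>
  For an admissible variation the boundary terms of the discrete action sum telescope along the rows
  and columns of the mesh. What remains is the sum over all elements of the residuals of Hamilton's
  equations, each paired with the value of the variation on one edge; variations supported on a single
  edge isolate the residuals.

  On first variations \<open>V\<close>, \<open>W\<close> Hamilton's equations turn every term of the multisymplectic form into
  a value of the second derivative of \<open>H\<close>, and together they give \<open>D\<^sup>2H(V, W) - D\<^sup>2H(W, V) = 0\<close>.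
\<close>

section \<open>Coordinates on a finite-dimensional normed space\<close>

text \<open>Finite dimension is known only through a basis \<open>B\<close>, and the norm is
  arbitrary. So continuity of the coordinates has to be derived; it makes them elements of the dual,
  and the resulting dual basis gives sense to the \<open>THE\<close> in \<open>of_bidual\<close>. A
  second obstacle is that \<open>smooth\<close> speaks of directional derivatives only:
  differentiability of a gradient with values in Q or its dual is not assumed, so the gradient is
  written as a finite sum over \<open>B\<close> with scalar coefficients. Third, the iterated
  derivative is visibly linear only in the direction of the outer differentiation; linearity in the
  inner direction is taken from symmetry, which thus serves to reassemble coordinates as well as for
  the final cancellation. On the variational side, the derivative of the action is computed at every
  configuration with shared edges, stationary or not, so the principle is equivalent to the
  equations and does not merely imply them.\<close>

locale finite_basis =
  fixes B :: "'q::real_normed_vector set"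
  assumes finite_B: "finite B" and independent_B: "independent B" and span_B: "span B = UNIV"
begin

lemma basis_expansion: "(\<Sum>A\<in>B. representation B q A *\<^sub>R A) = q"
  using sum_representation_eq[OF independent_B, of q B] finite_B span_B by simp

lemma representation_sum_basis:
  assumes "A \<in> B"
  shows "representation B (\<Sum>A\<in>B. f A *\<^sub>R A) A = f A"
proof -
  have "representation B (\<Sum>A\<in>B. f A *\<^sub>R A) A = (\<Sum>A'\<in>B. representation B (f A' *\<^sub>R A') A)"
    by (subst representation_sum[OF independent_B]) (auto simp: span_B)
  also have "\<dots> = (\<Sum>A'\<in>B. if A' = A then f A' else 0)"
    by (rule sum.cong)
      (auto simp: representation_scale[OF independent_B] representation_basis[OF independent_B] span_B)
  finally show ?thesis using assms finite_B by simp
qed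

text \<open>The coefficient vectors with maximum norm 1 form a compact set, on which the norm of the
  linear combination attains a positive minimum.\<close>

lemma coord_bound:
  obtains m where "m > 0" "\<And>q A. A \<in> B \<Longrightarrow> \<bar>representation B q A\<bar> * m \<le> norm q"
proof -
  \<comment> \<open>Coefficients outside \<open>B\<close> are pinned to 0, so that a product over
    the whole type is compact in the topology of pointwise convergence.\<close>
  define C where "C = PiE UNIV (\<lambda>A. if A \<in> B then {-1..1::real} else {0})"
  define K where "K = C \<inter> (\<Union>A\<in>B. {f. \<bar>f A\<bar> = 1})"
  define F where "F f = norm (\<Sum>A\<in>B. f A *\<^sub>R A)" for f :: "'q \<Rightarrow> real"
  have contF: "continuous_on S F" for S
    unfolding F_def by (intro continuous_intros continuous_on_product_coordinates[THEN continuous_on_subset]) auto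
  have "compactin (product_topology (\<lambda>_. euclidean) UNIV) C"
    unfolding C_def compactin_PiE by auto
  then have "compact C"
    by (simp add: euclidean_product_topology compactin_euclidean_iff)
  moreover have "closed (\<Union>A\<in>B. {f::'q \<Rightarrow> real. \<bar>f A\<bar> = 1})"
    using finite_B
    by (intro closed_UN ballI closed_Collect_eq continuous_intros continuous_on_product_coordinates) 
  ultimately have cK: "compact K"
    unfolding K_def by (rule compact_Int_closed)
  have posF: "F f > 0" if "f \<in> K" for f
  proof -
    from that obtain A where A: "A \<in> B" "\<bar>f A\<bar> = 1" by (auto simp: K_def)
    then have "(\<Sum>A\<in>B. f A *\<^sub>R A) \<noteq> 0"
      using representation_sum_basis[of A f] by (auto simp: representation_zero)
    then show ?thesis by (simp add: F_def)
  qed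
  obtain m where m: "m > 0" "\<And>f. f \<in> K \<Longrightarrow> m \<le> F f"
  proof (cases "K = {}")
    case True
    \<comment> \<open>\<open>K\<close> is empty only when \<open>B\<close> is, and then any positive
      constant will do.\<close>
    then show ?thesis using that[of 1] by auto
  next
    case False
    then obtain f where "f \<in> K" "\<And>g. g \<in> K \<Longrightarrow> F f \<le> F g"
      using continuous_attains_inf[OF cK _ contF] by blast
    then show ?thesis using posF that by blast
  qed
  show ?thesis
  proof (rule that[OF m(1)])
    fix q A assume A: "A \<in> B"
    let ?c = "\<lambda>A. \<bar>representation B q A\<bar>"
    define M where "M = Max (?c ` B)"
    have le: "?c A' \<le> M" if "A' \<in> B" for A'
      unfolding M_def using finite_B that by simp
    have "M \<in> ?c ` B" unfolding M_def using finite_B A by (intro Max_in) auto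
    then obtain A0 where A0: "A0 \<in> B" "?c A0 = M" by auto
    have "M * m \<le> norm q"
    proof (cases "M = 0")
      case False
      with le[OF A] have Mp: "M > 0" by (smt (verit) A0(2))
      \<comment> \<open>Dividing by the largest coefficient moves the coefficient vector into
        \<open>K\<close>; by homogeneity the minimum over \<open>K\<close> then bounds the original
        vector.\<close>
      define f where "f A' = (if A' \<in> B then representation B q A' / M else 0)" for A'
      have "- 1 \<le> f A'" "f A' \<le> 1" if "A' \<in> B" for A'
        using le[OF that] Mp that by (auto simp: f_def divide_simps)
      then have "f \<in> C" by (auto simp: C_def f_def)
      moreover have "\<bar>f A0\<bar> = 1" using A0 Mp by (simp add: f_def)
      ultimately have "f \<in> K" using A0 by (auto simp: K_def)
      then have "m \<le> F f" by (rule m)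
      also have "F f = norm ((1 / M) *\<^sub>R (\<Sum>A\<in>B. representation B q A *\<^sub>R A))"
        unfolding F_def scaleR_sum_right f_def by (simp cong: sum.cong)
      also have "\<dots> = norm q / M" using Mp by (simp only: basis_expansion) simp
      finally show ?thesis using Mp by (simp add: field_simps)
    qed simp
    moreover have "?c A * m \<le> M * m" using le[OF A] m(1) by simp
    ultimately show "?c A * m \<le> norm q" by linarith
  qed
qed

lemma bounded_linear_coord: "bounded_linear (\<lambda>q. representation B q A)"
proof (cases "A \<in> B")
  case True
  obtain m where "m > 0" "\<And>q A. A \<in> B \<Longrightarrow> \<bar>representation B q A\<bar> * m \<le> norm q"
    using coord_bound by blast
  with True have "norm (representation B q A) \<le> norm q * (1 / m)" for q
    by (simp add: field_simps)
  then show ?thesis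
    by (intro bounded_linear_intro[where K = "1 / m"])
      (simp_all add: representation_add[OF independent_B] representation_scale[OF independent_B] span_B)
next
  case False
  then have "representation B q A = 0" for q
    using representation_ne_zero by blast
  then show ?thesis by simp
qed

definition dual_basis :: "'q \<Rightarrow> 'q dual"
  where "dual_basis A = Blinfun (\<lambda>q. representation B q A)"

lemma dual_basis_apply [simp]: "blinfun_apply (dual_basis A) q = representation B q A"
  by (simp add: dual_basis_def bounded_linear_Blinfun_apply bounded_linear_coord)

lemma dual_expansion: "(\<Sum>A\<in>B. blinfun_apply p A *\<^sub>R dual_basis A) = p"
proof (rule blinfun_eqI)
  fix q
  have "blinfun_apply p q = blinfun_apply p (\<Sum>A\<in>B. representation B q A *\<^sub>R A)"
    by (simp add: basis_expansion)
  also have "\<dots> = (\<Sum>A\<in>B. blinfun_apply p A * representation B q A)"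
    by (simp add: blinfun.sum_right blinfun.scaleR_right mult.commute)
  finally show "blinfun_apply (\<Sum>A\<in>B. blinfun_apply p A *\<^sub>R dual_basis A) q = blinfun_apply p q"
    by (simp add: blinfun.sum_left blinfun.scaleR_left)
qed

text \<open>Reflexivity in explicit form: expanding \<open>p\<close> in the dual basis shows that
  \<open>L\<close> is evaluation at one particular vector, and testing with the dual basis shows
  that no other vector works. The formula also makes \<open>D3\<close> and \<open>D4\<close>
  accessible to differentiation.\<close>

lemma of_bidual_eq:
  assumes "linear L"
  shows "of_bidual L = (\<Sum>A\<in>B. L (dual_basis A) *\<^sub>R A)"
  unfolding of_bidual_def
proof (rule the_equality, intro allI)
  fix p
  have "L p = L (\<Sum>A\<in>B. blinfun_apply p A *\<^sub>R dual_basis A)"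
    by (simp add: dual_expansion)
  also have "\<dots> = (\<Sum>A\<in>B. L (dual_basis A) * blinfun_apply p A)"
    by (simp add: linear_sum[OF assms] linear_cmul[OF assms] mult.commute)
  finally show "L p = blinfun_apply p (\<Sum>A\<in>B. L (dual_basis A) *\<^sub>R A)"
    by (simp add: blinfun.sum_right blinfun.scaleR_right)
next
  fix q assume "\<forall>p. L p = blinfun_apply p q"
  then show "q = (\<Sum>A\<in>B. L (dual_basis A) *\<^sub>R A)"
    by (simp add: basis_expansion)
qed

end

section \<open>Symmetry of second derivatives\<close>

text \<open>The mean value theorem is applied twice: along \<open>v\<close> to the difference of
  \<open>f\<close> on two parallel segments, then along \<open>w\<close> to the directional
  derivative that results. The intermediate point lies in the parallelogram spanned by
  \<open>t *\<^sub>R v\<close> and \<open>t *\<^sub>R w\<close>.\<close>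

lemma mixed_difference_mvt:
  fixes f :: "'a::real_normed_vector \<Rightarrow> real"
  assumes f: "\<And>x. f differentiable (at x)"
    and f': "\<And>x. (\<lambda>x. frechet_derivative f (at x) v) differentiable (at x)"
    and t: "t > 0"
  shows "\<exists>\<xi> \<eta>. 0 \<le> \<xi> \<and> \<xi> \<le> t \<and> 0 \<le> \<eta> \<and> \<eta> \<le> t \<and>
    f (x + t *\<^sub>R v + t *\<^sub>R w) - f (x + t *\<^sub>R v) - f (x + t *\<^sub>R w) + f x =
    t * t * frechet_derivative (\<lambda>x. frechet_derivative f (at x) v) (at (x + \<xi> *\<^sub>R v + \<eta> *\<^sub>R w)) w"
proof -
  have line: "((\<lambda>s. g (y + s *\<^sub>R u)) has_real_derivative frechet_derivative g (at (y + s *\<^sub>R u)) u) (at s)"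
    if g: "\<And>x. g differentiable (at x)" for g :: "'a \<Rightarrow> real" and y u s
  proof -
    have "((\<lambda>s. y + s *\<^sub>R u) has_derivative (\<lambda>h. h *\<^sub>R u)) (at s)"
      by (auto intro!: derivative_eq_intros)
    moreover have "(g has_derivative frechet_derivative g (at (y + s *\<^sub>R u))) (at (y + s *\<^sub>R u))"
      using g frechet_derivative_works by blast
    ultimately have "((\<lambda>s. g (y + s *\<^sub>R u)) has_derivative
        (\<lambda>h. frechet_derivative g (at (y + s *\<^sub>R u)) (h *\<^sub>R u))) (at s)"
      using has_derivative_compose by fastforce
    moreover have "frechet_derivative g (at (y + s *\<^sub>R u)) (h *\<^sub>R u) =
        frechet_derivative g (at (y + s *\<^sub>R u)) u * h" for h
      using linear_frechet_derivative[OF g] by (simp add: linear_cmul)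
    ultimately show ?thesis by (simp add: has_field_derivative_def)
  qed
  have "((\<lambda>s. f (x + t *\<^sub>R w + s *\<^sub>R v) - f (x + s *\<^sub>R v)) has_real_derivative
     frechet_derivative f (at (x + t *\<^sub>R w + s *\<^sub>R v)) v - frechet_derivative f (at (x + s *\<^sub>R v)) v) (at s)" for s
    by (intro derivative_intros line f)
  from MVT2[OF t, of "\<lambda>s. f (x + t *\<^sub>R w + s *\<^sub>R v) - f (x + s *\<^sub>R v)", OF this]
  obtain \<xi> where \<xi>: "0 < \<xi>" "\<xi> < t" and eq1:
    "(f (x + t *\<^sub>R w + t *\<^sub>R v) - f (x + t *\<^sub>R v)) - (f (x + t *\<^sub>R w) - f x) =
     t * (frechet_derivative f (at (x + t *\<^sub>R w + \<xi> *\<^sub>R v)) v - frechet_derivative f (at (x + \<xi> *\<^sub>R v)) v)"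
    by auto
  from MVT2[OF t, of "\<lambda>s. frechet_derivative f (at (x + \<xi> *\<^sub>R v + s *\<^sub>R w)) v", OF line[OF f']]
  obtain \<eta> where \<eta>: "0 < \<eta>" "\<eta> < t" and eq2:
    "frechet_derivative f (at (x + \<xi> *\<^sub>R v + t *\<^sub>R w)) v - frechet_derivative f (at (x + \<xi> *\<^sub>R v)) v =
     t * frechet_derivative (\<lambda>x. frechet_derivative f (at x) v) (at (x + \<xi> *\<^sub>R v + \<eta> *\<^sub>R w)) w"
    by auto
  have c: "x + t *\<^sub>R w + s *\<^sub>R v = x + s *\<^sub>R v + t *\<^sub>R w" for s by (simp add: algebra_simps)
  show ?thesis
    using \<xi> \<eta> eq1 eq2 unfolding c by (intro exI[of _ \<xi>] exI[of _ \<eta>]) (simp add: algebra_simps)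
qed

text \<open>Schwarz's theorem for iterated directional derivatives: the second difference quotient
  does not change when \<open>v\<close> and \<open>w\<close> are exchanged, and by continuity it
  converges to both mixed derivatives.\<close>

lemma second_derivative_symmetric:
  fixes f :: "'a::real_normed_vector \<Rightarrow> real"
  defines "K \<equiv> \<lambda>v w x. frechet_derivative (\<lambda>x. frechet_derivative f (at x) v) (at x) w"
  assumes f: "\<And>x. f differentiable (at x)"
    and f': "\<And>v x. (\<lambda>x. frechet_derivative f (at x) v) differentiable (at x)"
    and f'': "\<And>v w. continuous_on UNIV (K v w)"
  shows "K v w x = K w v x"
proof -
  define t :: "nat \<Rightarrow> real" where "t n = inverse (real (Suc n))" for n
  have t: "t n > 0" for n by (simp add: t_def)
  have t0: "t \<longlonglongrightarrow> 0" unfolding t_def by (rule LIMSEQ_inverse_real_of_nat)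
  define \<Delta> where "\<Delta> v w n = (f (x + t n *\<^sub>R v + t n *\<^sub>R w) - f (x + t n *\<^sub>R v) - f (x + t n *\<^sub>R w) + f x) /
    (t n * t n)" for v w n
  have lim: "\<Delta> v w \<longlonglongrightarrow> K v w x" for v w
  proof -
    have "\<forall>n. \<exists>\<xi> \<eta>. 0 \<le> \<xi> \<and> \<xi> \<le> t n \<and> 0 \<le> \<eta> \<and> \<eta> \<le> t n \<and>
        \<Delta> v w n = K v w (x + \<xi> *\<^sub>R v + \<eta> *\<^sub>R w)"
    proof
      fix n
      show "\<exists>\<xi> \<eta>. 0 \<le> \<xi> \<and> \<xi> \<le> t n \<and> 0 \<le> \<eta> \<and> \<eta> \<le> t n \<and>
        \<Delta> v w n = K v w (x + \<xi> *\<^sub>R v + \<eta> *\<^sub>R w)"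
        using mixed_difference_mvt[OF f f' t[of n], of x v w] t[of n]
        unfolding \<Delta>_def K_def by (elim ex_forward conj_forward) simp_all
    qed
    then obtain \<xi> \<eta> where b: "\<And>n. 0 \<le> \<xi> n" "\<And>n. \<xi> n \<le> t n" "\<And>n. 0 \<le> \<eta> n" "\<And>n. \<eta> n \<le> t n"
      and eq: "\<And>n. \<Delta> v w n = K v w (x + \<xi> n *\<^sub>R v + \<eta> n *\<^sub>R w)"
      by metis
    have "\<xi> \<longlonglongrightarrow> 0" "\<eta> \<longlonglongrightarrow> 0"
      using b by (auto intro!: tendsto_sandwich[OF _ _ tendsto_const t0])
    then have "(\<lambda>n. x + \<xi> n *\<^sub>R v + \<eta> n *\<^sub>R w) \<longlonglongrightarrow> x + 0 *\<^sub>R v + 0 *\<^sub>R w"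
      by (intro tendsto_intros)
    then have "(\<lambda>n. x + \<xi> n *\<^sub>R v + \<eta> n *\<^sub>R w) \<longlonglongrightarrow> x" by simp
    moreover have "isCont (K v w) x"
      using f''[of v w] by (simp add: continuous_on_eq_continuous_at)
    ultimately show ?thesis
      unfolding eq by (rule isCont_tendsto_compose[rotated])
  qed
  have "\<Delta> v w = \<Delta> w v"
    by (auto simp: \<Delta>_def fun_eq_iff algebra_simps)
  then show ?thesis
    using lim[of v w] lim[of w v] LIMSEQ_unique by metis
qed

section \<open>Calculus with smooth and bounded linear maps\<close>

lemma linear_combination:
  fixes L :: "'a::real_vector \<Rightarrow> real"
  assumes "linear L"
  shows "L (\<Sum>x\<in>S. c x *\<^sub>R v x) = (\<Sum>x\<in>S. c x * L (v x))"
  by (simp add: linear_sum[OF assms] linear_cmul[OF assms])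

lemma frechet_derivative_eq:
  "(f has_derivative f') (at x) \<Longrightarrow> frechet_derivative f (at x) = f'"
  by (rule frechet_derivative_at[symmetric])

lemma frechet_derivative_bounded_linear:
  assumes "bounded_linear f"
  shows "frechet_derivative f (at z) = f"
  by (rule frechet_derivative_eq[OF bounded_linear_imp_has_derivative[OF assms]])

lemma smooth_differentiable:
  assumes "smooth f"
  shows "f differentiable (at x)"
proof -
  have "C_diff (Suc 0) f" using assms unfolding smooth_def by blast
  then show ?thesis by simp
qed

lemma smooth_derivative_differentiable:
  assumes "smooth f"
  shows "(\<lambda>x. frechet_derivative f (at x) v) differentiable (at x)"
proof -
  have "C_diff (Suc (Suc 0)) f" using assms unfolding smooth_def by blast
  then show ?thesis by simp
qed

lemma smooth_second_derivative_symmetric: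
  fixes f :: "'a::real_normed_vector \<Rightarrow> real"
  assumes "smooth f"
  shows "frechet_derivative (\<lambda>x. frechet_derivative f (at x) v) (at x) w =
    frechet_derivative (\<lambda>x. frechet_derivative f (at x) w) (at x) v"
proof (rule second_derivative_symmetric)
  have "C_diff (Suc (Suc 0)) f" using assms unfolding smooth_def by blast
  then show "continuous_on UNIV (\<lambda>x. frechet_derivative (\<lambda>x. frechet_derivative f (at x) v) (at x) w)" for v w
    by simp
qed (use assms in \<open>auto intro: smooth_differentiable smooth_derivative_differentiable\<close>)

lemma smooth_bounded_linear_derivative:
  "smooth f \<Longrightarrow> bounded_linear (frechet_derivative f (at x))"
  using smooth_differentiable frechet_derivative_works has_derivative_bounded_linear by blast

text \<open>The chain rule for an affine map that sends \<open>y0\<close> to \<open>a\<close>.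
  Replacing one component of a vector is such a map, so partial derivatives become values of the
  total derivative.\<close>

lemma frechet_derivative_affine:
  assumes f: "f differentiable (at a)" and J: "bounded_linear J"
  shows "frechet_derivative (\<lambda>y. f (a + J (y - y0))) (at y0) = (\<lambda>h. frechet_derivative f (at a) (J h))"
proof -
  interpret J: bounded_linear J by (rule J)
  have "((\<lambda>y. a + J (y - y0)) has_derivative J) (at y0)"
    by (auto intro!: derivative_eq_intros J.has_derivative)
  moreover have "(f has_derivative frechet_derivative f (at a)) (at (a + J (y0 - y0)))"
    using f by (simp add: J.zero frechet_derivative_works[symmetric])
  ultimately have "((\<lambda>y. f (a + J (y - y0))) has_derivative (\<lambda>h. frechet_derivative f (at a) (J h))) (at y0)"
    using has_derivative_compose by blast
  then show ?thesis by (rule frechet_derivative_eq)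
qed

section \<open>Boundary values as a linear space\<close>

lemma bounded_linear_axis: "bounded_linear (axis i :: 'a::real_normed_vector \<Rightarrow> 'a ^ 'i::finite)"
proof (rule bounded_linear_intro[where K = 1])
  fix x :: 'a
  have "norm (axis i x :: 'a ^ 'i) \<le> (\<Sum>j\<in>UNIV. norm ((axis i x :: 'a ^ 'i) $ j))"
    unfolding norm_vec_def by (rule L2_set_le_sum) auto
  also have "\<dots> = (\<Sum>j\<in>UNIV. if j = i then norm x else 0)"
    by (rule sum.cong) (auto simp: axis_def)
  finally show "norm (axis i x :: 'a ^ 'i) \<le> norm x * 1" by simp
qed (auto simp: axis_def vec_eq_iff)

lemma vec_upd_eq: "vec_upd u i y = u + axis i (y - u $ i)" for u :: "'a::real_normed_vector ^ 'i::finite"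
  by (auto simp: vec_upd_def axis_def vec_eq_iff)

lemma sum_axis: "(\<Sum>i\<in>UNIV. axis i (u $ i)) = u" for u :: "'a::real_normed_vector ^ 'i::finite"
  by (auto simp: vec_eq_iff axis_def if_distrib cong: if_cong)

text \<open>The injections of a single nodal value into the four slots of the argument of the
  Hamiltonian. Partial derivatives are the total derivative composed with them.\<close>

definition in1 :: "'s \<Rightarrow> 'q \<Rightarrow> ('q::real_normed_vector, 's::finite, 'r::finite) ham_arg"
  where "in1 i q = (axis i q, 0, 0, 0)"

definition in2 :: "'r \<Rightarrow> 'q \<Rightarrow> ('q::real_normed_vector, 's::finite, 'r::finite) ham_arg"
  where "in2 \<alpha> q = (0, axis \<alpha> q, 0, 0)"

definition in3 :: "'s \<Rightarrow> 'q dual \<Rightarrow> ('q::real_normed_vector, 's::finite, 'r::finite) ham_arg"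
  where "in3 i p = (0, 0, axis i p, 0)"

definition in4 :: "'r \<Rightarrow> 'q dual \<Rightarrow> ('q::real_normed_vector, 's::finite, 'r::finite) ham_arg"
  where "in4 \<alpha> p = (0, 0, 0, axis \<alpha> p)"

lemma bounded_linear_in:
  "bounded_linear (in1 i)" "bounded_linear (in2 \<alpha>)" "bounded_linear (in3 i)" "bounded_linear (in4 \<alpha>)"
  unfolding in1_def[abs_def] in2_def[abs_def] in3_def[abs_def] in4_def[abs_def]
  by (intro bounded_linear_Pair bounded_linear_axis bounded_linear_zero)+

lemma linear_ham_arg_split:
  fixes L :: "('q::real_normed_vector, 's::finite, 'r::finite) ham_arg \<Rightarrow> real"
  assumes "linear L"
  shows "L (fx, ft, mx, mt) =
    (\<Sum>i\<in>UNIV. L (in1 i (fx $ i))) + (\<Sum>\<alpha>\<in>UNIV. L (in2 \<alpha> (ft $ \<alpha>))) +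
    (\<Sum>i\<in>UNIV. L (in3 i (mx $ i))) + (\<Sum>\<alpha>\<in>UNIV. L (in4 \<alpha> (mt $ \<alpha>)))"
proof -
  have "(fx, ft, mx, mt) = (\<Sum>i\<in>UNIV. in1 i (fx $ i)) + (\<Sum>\<alpha>\<in>UNIV. in2 \<alpha> (ft $ \<alpha>)) +
    (\<Sum>i\<in>UNIV. in3 i (mx $ i)) + (\<Sum>\<alpha>\<in>UNIV. in4 \<alpha> (mt $ \<alpha>))"
    by (simp add: prod_eq_iff fst_sum snd_sum in1_def in2_def in3_def in4_def sum_axis)
  then show ?thesis
    by (simp only: linear_add[OF assms] linear_sum[OF assms])
qed

lemmas bdry_defs = phi_x0_def phi_x1_def phi_t0_def phi_t1_def mom_x0_def mom_x1_def mom_t0_def mom_t1_def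

lemma bounded_linear_bdry:
  "bounded_linear phi_x0" "bounded_linear phi_x1" "bounded_linear phi_t0" "bounded_linear phi_t1"
  "bounded_linear mom_x0" "bounded_linear mom_x1" "bounded_linear mom_t0" "bounded_linear mom_t1"
  unfolding bdry_defs case_prod_beta'
  by (intro bounded_linear_intros bounded_linear_fst_comp bounded_linear_snd_comp bounded_linear_ident)+

lemma bounded_linear_bdry_nth:
  "bounded_linear (\<lambda>z. phi_x0 z $ i)" "bounded_linear (\<lambda>z. phi_x1 z $ i)"
  "bounded_linear (\<lambda>z. phi_t0 z $ \<alpha>)" "bounded_linear (\<lambda>z. phi_t1 z $ \<alpha>)"
  "bounded_linear (\<lambda>z. mom_x0 z $ i)" "bounded_linear (\<lambda>z. mom_x1 z $ i)"
  "bounded_linear (\<lambda>z. mom_t0 z $ \<alpha>)" "bounded_linear (\<lambda>z. mom_t1 z $ \<alpha>)"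
  by (rule bounded_linear_compose[OF bounded_linear_vec_nth], rule bounded_linear_bdry)+

lemma bounded_linear_ham_args: "bounded_linear ham_args"
  unfolding ham_args_def[abs_def] by (intro bounded_linear_Pair bounded_linear_bdry)

section \<open>Duality pairings and exterior derivatives of gradients\<close>

context finite_basis
begin

lemma dual_separates:
  fixes q :: 'q
  assumes "\<And>p :: 'q dual. blinfun_apply p q = 0"
  shows "q = 0"
proof -
  have "representation B q A = 0" for A
    using assms[of "dual_basis A"] by simp
  then show ?thesis using basis_expansion[of q] by simp
qed

lemma blinfun_apply_of_bidual:
  fixes L :: "'q dual \<Rightarrow> real"
  assumes "linear L"
  shows "blinfun_apply p (of_bidual L) = L p"
proof -
  have "L p = L (\<Sum>A\<in>B. blinfun_apply p A *\<^sub>R dual_basis A)"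
    by (simp add: dual_expansion)
  then show ?thesis
    by (simp add: of_bidual_eq assms linear_sum[OF assms] linear_cmul[OF assms]
        blinfun.sum_right blinfun.scaleR_right mult.commute)
qed

text \<open>A bounded linear map is its own derivative, and the sum over dual coordinates is the
  duality pairing. This removes the basis from the two-form.\<close>

lemma dphi_wedge_dpi_linear:
  fixes f :: "'a::real_normed_vector \<Rightarrow> 'q"
  assumes f: "bounded_linear f" and g: "bounded_linear g"
  shows "dphi_wedge_dpi B f g z V W = blinfun_apply (g W) (f V) - blinfun_apply (g V) (f W)"
proof -
  have 1: "ext_d (\<lambda>w. representation B (f w) A) z = (\<lambda>w. representation B (f w) A)" for A
    by (rule frechet_derivative_bounded_linear) (rule bounded_linear_compose[OF bounded_linear_coord f])
  have 2: "ext_d (\<lambda>w. blinfun_apply (g w) A) z = (\<lambda>w. blinfun_apply (g w) A)" for A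
    by (rule frechet_derivative_bounded_linear)
      (rule bounded_linear_compose[OF blinfun.bounded_linear_left g])
  have 3: "blinfun_apply p q = (\<Sum>A\<in>B. representation B q A * blinfun_apply p A)" for p :: "'q dual" and q
    by (subst basis_expansion[of q, symmetric]) (simp add: blinfun.sum_right blinfun.scaleR_right)
  show ?thesis
    unfolding dphi_wedge_dpi_def wedge_def 1 2 3[of "g V" "f W"] 3[of "g W" "f V"]
    by (rule sum_subtractf)
qed

text \<open>Expanding the gradient in the dual basis leaves scalar functions, whose derivatives
  exist by smoothness; the expansion is then undone at \<open>q\<close>.\<close>

lemma derivative_gradient:
  fixes f :: "'a::real_normed_vector \<Rightarrow> real" and J :: "'q \<Rightarrow> 'a"
  assumes f: "smooth f" and J: "bounded_linear J" and h: "bounded_linear h"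
  shows "blinfun_apply (ext_d (\<lambda>w. Blinfun (\<lambda>q. frechet_derivative f (at (h w)) (J q))) z V) q =
    ext_d (\<lambda>x. frechet_derivative f (at x) (J q)) (h z) (h V)"
proof -
  let ?K = "\<lambda>v u. ext_d (\<lambda>x. frechet_derivative f (at x) u) (h z) v"
  have bl: "bounded_linear (\<lambda>q. frechet_derivative f (at x) (J q))" for x
    by (rule bounded_linear_compose[OF smooth_bounded_linear_derivative[OF f] J])
  have "((\<lambda>w. frechet_derivative f (at (h w)) u) has_derivative (\<lambda>V. ?K (h V) u)) (at z)" for u
    by (rule has_derivative_compose[OF bounded_linear_imp_has_derivative[OF h]])
      (use smooth_derivative_differentiable[OF f] in \<open>simp add: frechet_derivative_works[symmetric]\<close>)
  then have "((\<lambda>w. \<Sum>A\<in>B. frechet_derivative f (at (h w)) (J A) *\<^sub>R dual_basis A) has_derivative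
      (\<lambda>V. \<Sum>A\<in>B. ?K (h V) (J A) *\<^sub>R dual_basis A)) (at z)"
    by (auto intro!: derivative_eq_intros)
  moreover have "Blinfun (\<lambda>q. frechet_derivative f (at (h w)) (J q)) =
      (\<Sum>A\<in>B. frechet_derivative f (at (h w)) (J A) *\<^sub>R dual_basis A)" for w
    using dual_expansion[of "Blinfun (\<lambda>q. frechet_derivative f (at (h w)) (J q))"]
    by (simp add: bounded_linear_Blinfun_apply[OF bl])
  ultimately have "ext_d (\<lambda>w. Blinfun (\<lambda>q. frechet_derivative f (at (h w)) (J q))) z V =
      (\<Sum>A\<in>B. ?K (h V) (J A) *\<^sub>R dual_basis A)"
    by (simp only: frechet_derivative_eq)
  also have "blinfun_apply \<dots> q = (\<Sum>A\<in>B. representation B q A * ?K (h V) (J A))"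
    by (simp add: blinfun.sum_left blinfun.scaleR_left mult.commute)
  also have "\<dots> = ?K (h V) (J (\<Sum>A\<in>B. representation B q A *\<^sub>R A))"
  proof -
    \<comment> \<open>Linearity is immediate in the direction of the outer derivative; symmetry
      carries it over to the inner slot, where the basis sum has to be pulled in.\<close>
    have "linear (\<lambda>q. ?K (J q) (h V))"
      using linear_compose[OF bounded_linear.linear[OF J]
          linear_frechet_derivative[OF smooth_derivative_differentiable[OF f]]]
      by (simp add: o_def)
    then have lin': "linear (\<lambda>q. ?K (h V) (J q))"
      by (simp add: smooth_second_derivative_symmetric[OF f, of "h V"])
    show ?thesis by (rule linear_combination[OF lin', of "representation B q" "\<lambda>A. A" B, symmetric])
  qed
  finally show ?thesis by (simp add: basis_expansion)
qed

text \<open>The counterpart for momentum slots: \<open>of_bidual_eq\<close> turns the gradient into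
  a finite sum of vectors of \<open>B\<close>, and the result is tested against a
  functional.\<close>

lemma derivative_dual_gradient:
  fixes f :: "'a::real_normed_vector \<Rightarrow> real" and J :: "'q dual \<Rightarrow> 'a"
  assumes f: "smooth f" and J: "bounded_linear J" and h: "bounded_linear h"
  shows "blinfun_apply p (ext_d (\<lambda>w. of_bidual (\<lambda>p. frechet_derivative f (at (h w)) (J p))) z V) =
    ext_d (\<lambda>x. frechet_derivative f (at x) (J p)) (h z) (h V)"
proof -
  let ?K = "\<lambda>v u. ext_d (\<lambda>x. frechet_derivative f (at x) u) (h z) v"
  have lin: "linear (\<lambda>p. frechet_derivative f (at x) (J p))" for x
    by (rule bounded_linear.linear[OF bounded_linear_compose[OF smooth_bounded_linear_derivative[OF f] J]])
  have "((\<lambda>w. frechet_derivative f (at (h w)) u) has_derivative (\<lambda>V. ?K (h V) u)) (at z)" for u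
    by (rule has_derivative_compose[OF bounded_linear_imp_has_derivative[OF h]])
      (use smooth_derivative_differentiable[OF f] in \<open>simp add: frechet_derivative_works[symmetric]\<close>)
  then have "((\<lambda>w. \<Sum>A\<in>B. frechet_derivative f (at (h w)) (J (dual_basis A)) *\<^sub>R A) has_derivative
      (\<lambda>V. \<Sum>A\<in>B. ?K (h V) (J (dual_basis A)) *\<^sub>R A)) (at z)"
    by (auto intro!: derivative_eq_intros)
  then have "ext_d (\<lambda>w. of_bidual (\<lambda>p. frechet_derivative f (at (h w)) (J p))) z V =
      (\<Sum>A\<in>B. ?K (h V) (J (dual_basis A)) *\<^sub>R A)"
    by (simp only: of_bidual_eq[OF lin] frechet_derivative_eq)
  also have "blinfun_apply p \<dots> = (\<Sum>A\<in>B. blinfun_apply p A * ?K (h V) (J (dual_basis A)))"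
    by (simp add: blinfun.sum_right blinfun.scaleR_right mult.commute)
  also have "\<dots> = ?K (h V) (J (\<Sum>A\<in>B. blinfun_apply p A *\<^sub>R dual_basis A))"
  proof -
    have "linear (\<lambda>q. ?K (J q) (h V))"
      using linear_compose[OF bounded_linear.linear[OF J]
          linear_frechet_derivative[OF smooth_derivative_differentiable[OF f]]]
      by (simp add: o_def)
    then have lin': "linear (\<lambda>q. ?K (h V) (J q))"
      by (simp add: smooth_second_derivative_symmetric[OF f, of "h V"])
    show ?thesis by (rule linear_combination[OF lin', of "blinfun_apply p" dual_basis B, symmetric])
  qed
  finally show ?thesis by (simp add: dual_expansion)
qed

end

text \<open>Summation by parts along one row or column. \<open>a\<close> is the contribution of the
  outgoing edges and \<open>c\<close> that of the incoming ones, which agree on shared edges;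
  \<open>d\<close> stays where it is and vanishes at the far end.\<close>

lemma sum_shift_edges:
  fixes a c d :: "nat \<Rightarrow> real"
  assumes "M \<ge> 1" and "\<And>n. n + 1 < M \<Longrightarrow> a n = c (n + 1)" and "c 0 = 0" and "d (M - 1) = 0"
  shows "(\<Sum>n<M. a n + d n) - (a (M - 1) + d (M - 1)) = (\<Sum>n<M. c n + d n)"
proof -
  obtain k where k: "M = Suc k" using assms(1) by (cases M) auto
  have "(\<Sum>n<k. a n) = (\<Sum>n<k. c (Suc n))"
    using assms(2) by (intro sum.cong) (auto simp: k)
  then show ?thesis
    using assms(3,4) sum.lessThan_Suc_shift[of c k] by (simp add: k sum.distrib)
qed

section \<open>Partial derivatives and the conservation law\<close>

locale boundary_hamiltonian = finite_basis B
  for B :: "'q::real_normed_vector set" +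
  fixes dt dx :: real and b :: "'s::finite \<Rightarrow> real" and b' :: "'r::finite \<Rightarrow> real"
    and H :: "('q, 's, 'r) ham_arg \<Rightarrow> real"
  assumes dt_b: "dt * b i \<noteq> 0" and dx_b': "dx * b' \<alpha> \<noteq> 0" and smooth_H: "smooth H"
begin

abbreviation DH :: "('q, 's, 'r) ham_arg \<Rightarrow> ('q, 's, 'r) ham_arg \<Rightarrow> real"
  where "DH a \<equiv> frechet_derivative H (at a)"

lemma bounded_linear_DH_in:
  "bounded_linear (\<lambda>q. DH a (in1 i q))" "bounded_linear (\<lambda>q. DH a (in2 \<alpha> q))"
  "bounded_linear (\<lambda>p. DH a (in3 i p))" "bounded_linear (\<lambda>p. DH a (in4 \<alpha> p))"
  by (rule bounded_linear_compose[OF smooth_bounded_linear_derivative[OF smooth_H]], rule bounded_linear_in)+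

lemma D1_eq: "D1 H i a = Blinfun (\<lambda>q. DH a (in1 i q))"
proof -
  obtain fx ft mx mt where a: "a = (fx, ft, mx, mt)" by (cases a)
  have "H (vec_upd fx i y, ft, mx, mt) = H (a + in1 i (y - fx $ i))" for y
    by (simp add: a in1_def vec_upd_eq)
  then show ?thesis
    using frechet_derivative_affine[OF smooth_differentiable[OF smooth_H] bounded_linear_in(1)]
    by (simp add: a D1_def)
qed

lemma D2_eq: "D2 H \<alpha> a = Blinfun (\<lambda>q. DH a (in2 \<alpha> q))"
proof -
  obtain fx ft mx mt where a: "a = (fx, ft, mx, mt)" by (cases a)
  have "H (fx, vec_upd ft \<alpha> y, mx, mt) = H (a + in2 \<alpha> (y - ft $ \<alpha>))" for y
    by (simp add: a in2_def vec_upd_eq)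
  then show ?thesis
    using frechet_derivative_affine[OF smooth_differentiable[OF smooth_H] bounded_linear_in(2)]
    by (simp add: a D2_def)
qed

lemma D3_eq: "D3 H i a = of_bidual (\<lambda>p. DH a (in3 i p))"
proof -
  obtain fx ft mx mt where a: "a = (fx, ft, mx, mt)" by (cases a)
  have "H (fx, ft, vec_upd mx i y, mt) = H (a + in3 i (y - mx $ i))" for y
    by (simp add: a in3_def vec_upd_eq)
  then show ?thesis
    using frechet_derivative_affine[OF smooth_differentiable[OF smooth_H] bounded_linear_in(3)]
    by (simp add: a D3_def)
qed

lemma D4_eq: "D4 H \<alpha> a = of_bidual (\<lambda>p. DH a (in4 \<alpha> p))"
proof -
  obtain fx ft mx mt where a: "a = (fx, ft, mx, mt)" by (cases a)
  have "H (fx, ft, mx, vec_upd mt \<alpha> y) = H (a + in4 \<alpha> (y - mt $ \<alpha>))" for y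
    by (simp add: a in4_def vec_upd_eq)
  then show ?thesis
    using frechet_derivative_affine[OF smooth_differentiable[OF smooth_H] bounded_linear_in(4)]
    by (simp add: a D4_def)
qed

lemma partial_derivative_apply:
  "blinfun_apply (D1 H i a) q = DH a (in1 i q)"
  "blinfun_apply (D2 H \<alpha> a) q = DH a (in2 \<alpha> q)"
  "blinfun_apply p (D3 H i a) = DH a (in3 i p)"
  "blinfun_apply p (D4 H \<alpha> a) = DH a (in4 \<alpha> p)"
  using bounded_linear_DH_in[THEN bounded_linear.linear]
  by (simp_all add: D1_eq D2_eq D3_eq D4_eq bounded_linear_Blinfun_apply bounded_linear_DH_in
      blinfun_apply_of_bidual)

lemma DH_split:
  "DH a (ham_args V) =
    (\<Sum>i\<in>UNIV. blinfun_apply (D1 H i a) (phi_x0 V $ i)) +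
    (\<Sum>\<alpha>\<in>UNIV. blinfun_apply (D2 H \<alpha> a) (phi_t0 V $ \<alpha>)) +
    (\<Sum>i\<in>UNIV. blinfun_apply (mom_x1 V $ i) (D3 H i a)) +
    (\<Sum>\<alpha>\<in>UNIV. blinfun_apply (mom_t1 V $ \<alpha>) (D4 H \<alpha> a))"
  unfolding ham_args_def partial_derivative_apply
  by (rule linear_ham_arg_split[OF bounded_linear.linear[OF smooth_bounded_linear_derivative[OF smooth_H]]])

lemma multisymplectic_form_eq_0:
  assumes V: "first_variation dt dx b b' H z V" and W: "first_variation dt dx b b' H z W"
  shows "multisymplectic_form B dt dx b b' z V W = 0"
proof -
  define K where "K v u = ext_d (\<lambda>x. DH x u) (ham_args z) v" for v u
  have K_sym: "K v u = K u v" for v u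
    unfolding K_def by (rule smooth_second_derivative_symmetric[OF smooth_H])
  have "linear (\<lambda>v. K v u)" for u
    unfolding K_def by (rule linear_frechet_derivative[OF smooth_derivative_differentiable[OF smooth_H]])
  \<comment> \<open>The split acts in the second argument of \<open>K\<close>, whose linearity
    follows from that in the first by \<open>K_sym\<close>.\<close>
  then have K_split: "K v (ham_args W) =
    (\<Sum>i\<in>UNIV. K v (in1 i (phi_x0 W $ i))) + (\<Sum>\<alpha>\<in>UNIV. K v (in2 \<alpha> (phi_t0 W $ \<alpha>))) +
    (\<Sum>i\<in>UNIV. K v (in3 i (mom_x1 W $ i))) + (\<Sum>\<alpha>\<in>UNIV. K v (in4 \<alpha> (mom_t1 W $ \<alpha>)))" for v W
    unfolding ham_args_def by (intro linear_ham_arg_split) (simp add: K_sym[of v])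
  \<comment> \<open>These are Hamilton's equations differentiated along \<open>V\<close>, with the
    weights cleared and both sides paired with a test vector or functional.\<close>
  have
    x0: "dt * b i * blinfun_apply (mom_x0 V $ i) q = K (ham_args V) (in1 i q)" and
    t0: "dx * b' \<alpha> * blinfun_apply (mom_t0 V $ \<alpha>) q = K (ham_args V) (in2 \<alpha> q)" and
    x1: "dt * b i * blinfun_apply p (phi_x1 V $ i) = K (ham_args V) (in3 i p)" and
    t1: "dx * b' \<alpha> * blinfun_apply p (phi_t1 V $ \<alpha>) = K (ham_args V) (in4 \<alpha> p)"
    if "first_variation dt dx b b' H z V" for V i \<alpha> p q
    using that dt_b[of i] dx_b'[of \<alpha>]
    unfolding first_variation_def D1_eq[abs_def] D2_eq[abs_def] D3_eq[abs_def] D4_eq[abs_def]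
    by (simp_all add: frechet_derivative_bounded_linear[OF bounded_linear_bdry_nth(2)]
        frechet_derivative_bounded_linear[OF bounded_linear_bdry_nth(4)]
        frechet_derivative_bounded_linear[OF bounded_linear_bdry_nth(5)]
        frechet_derivative_bounded_linear[OF bounded_linear_bdry_nth(7)]
        blinfun.scaleR_left blinfun.scaleR_right K_def
        derivative_gradient[OF smooth_H bounded_linear_in(1) bounded_linear_ham_args]
        derivative_gradient[OF smooth_H bounded_linear_in(2) bounded_linear_ham_args]
        derivative_dual_gradient[OF smooth_H bounded_linear_in(3) bounded_linear_ham_args]
        derivative_dual_gradient[OF smooth_H bounded_linear_in(4) bounded_linear_ham_args])
  \<comment> \<open>On index-1 edges the field is the dependent variable, on index-0 edges the
    momentum is. This exchange of roles offsets the minus sign in the form, so all four families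
    enter with the same sign.\<close>
  have "multisymplectic_form B dt dx b b' z V W = K (ham_args V) (ham_args W) - K (ham_args W) (ham_args V)"
    unfolding multisymplectic_form_def K_split
    by (simp add: dphi_wedge_dpi_linear bounded_linear_bdry_nth right_diff_distrib
        x0[OF V] x0[OF W] x1[OF V] x1[OF W] t0[OF V] t0[OF W] t1[OF V] t1[OF W]
        sum_subtractf)
  then show ?thesis using K_sym by simp
qed

section \<open>The variational principle\<close>

abbreviation res_mom_x0 :: "('q, 's, 'r) bdry \<Rightarrow> 's \<Rightarrow> 'q dual"
  where "res_mom_x0 z i \<equiv> D1 H i (ham_args z) - (dt * b i) *\<^sub>R (mom_x0 z $ i)"

abbreviation res_mom_t0 :: "('q, 's, 'r) bdry \<Rightarrow> 'r \<Rightarrow> 'q dual"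
  where "res_mom_t0 z \<alpha> \<equiv> D2 H \<alpha> (ham_args z) - (dx * b' \<alpha>) *\<^sub>R (mom_t0 z $ \<alpha>)"

abbreviation res_phi_x1 :: "('q, 's, 'r) bdry \<Rightarrow> 's \<Rightarrow> 'q"
  where "res_phi_x1 z i \<equiv> D3 H i (ham_args z) - (dt * b i) *\<^sub>R (phi_x1 z $ i)"

abbreviation res_phi_t1 :: "('q, 's, 'r) bdry \<Rightarrow> 'r \<Rightarrow> 'q"
  where "res_phi_t1 z \<alpha> \<equiv> D4 H \<alpha> (ham_args z) - (dx * b' \<alpha>) *\<^sub>R (phi_t1 z $ \<alpha>)"

lemma residual_eq_iff:
  "eq_mom_x0 dt b H z \<longleftrightarrow> (\<forall>i. res_mom_x0 z i = 0)"
  "eq_mom_t0 dx b' H z \<longleftrightarrow> (\<forall>\<alpha>. res_mom_t0 z \<alpha> = 0)"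
  "eq_phi_x1 dt b H z \<longleftrightarrow> (\<forall>i. res_phi_x1 z i = 0)"
  "eq_phi_t1 dx b' H z \<longleftrightarrow> (\<forall>\<alpha>. res_phi_t1 z \<alpha> = 0)"
proof -
  have iff: "x = (1 / (w * h)) *\<^sub>R y \<longleftrightarrow> y - (h * w) *\<^sub>R x = 0"
    if "h * w \<noteq> 0" for x y :: "'v::real_normed_vector" and h w :: real
  proof
    show "y - (h * w) *\<^sub>R x = 0" if "x = (1 / (w * h)) *\<^sub>R y"
      using \<open>h * w \<noteq> 0\<close> by (simp add: that)
    show "x = (1 / (w * h)) *\<^sub>R y" if "y - (h * w) *\<^sub>R x = 0"
    proof -
      have "y = (h * w) *\<^sub>R x" using that by simp
      then show ?thesis using \<open>h * w \<noteq> 0\<close> by simp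
    qed
  qed
  show "eq_mom_x0 dt b H z \<longleftrightarrow> (\<forall>i. res_mom_x0 z i = 0)"
    unfolding eq_mom_x0_def by (intro all_cong1 iff dt_b)
  show "eq_mom_t0 dx b' H z \<longleftrightarrow> (\<forall>\<alpha>. res_mom_t0 z \<alpha> = 0)"
    unfolding eq_mom_t0_def by (intro all_cong1 iff dx_b')
  show "eq_phi_x1 dt b H z \<longleftrightarrow> (\<forall>i. res_phi_x1 z i = 0)"
    unfolding eq_phi_x1_def by (intro all_cong1 iff dt_b)
  show "eq_phi_t1 dx b' H z \<longleftrightarrow> (\<forall>\<alpha>. res_phi_t1 z \<alpha> = 0)"
    unfolding eq_phi_t1_def by (intro all_cong1 iff dx_b')
qed

text \<open>The first variation in its final form: only variations of the four arguments of
  \<open>H\<close> occur. Field variations on outgoing edges have been passed to the neighbouring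
  element or absorbed by the boundary terms.\<close>

definition action_variation :: "nat \<Rightarrow> nat \<Rightarrow> ('q, 's, 'r) mesh_values \<Rightarrow> ('q, 's, 'r) mesh_values \<Rightarrow> real"
  where "action_variation N M Z \<delta> = (\<Sum>m<N. \<Sum>n<M.
    (\<Sum>i\<in>UNIV. blinfun_apply (res_mom_x0 (Z m n) i) (phi_x0 (\<delta> m n) $ i)) +
    (\<Sum>\<alpha>\<in>UNIV. blinfun_apply (res_mom_t0 (Z m n) \<alpha>) (phi_t0 (\<delta> m n) $ \<alpha>)) +
    (\<Sum>i\<in>UNIV. blinfun_apply (mom_x1 (\<delta> m n) $ i) (res_phi_x1 (Z m n) i)) +
    (\<Sum>\<alpha>\<in>UNIV. blinfun_apply (mom_t1 (\<delta> m n) $ \<alpha>) (res_phi_t1 (Z m n) \<alpha>)))"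

lemma pairing_derivative:
  fixes p dp :: "'q dual" and q dq :: 'q
  shows "((\<lambda>\<epsilon>::real. blinfun_apply (p + \<epsilon> *\<^sub>R dp) (q + \<epsilon> *\<^sub>R dq)) has_real_derivative
    blinfun_apply p dq + blinfun_apply dp q) (at 0)"
proof -
  have "(\<lambda>\<epsilon>::real. blinfun_apply (p + \<epsilon> *\<^sub>R dp) (q + \<epsilon> *\<^sub>R dq)) =
    (\<lambda>\<epsilon>. blinfun_apply p q + \<epsilon> * (blinfun_apply p dq + blinfun_apply dp q) +
      \<epsilon> * \<epsilon> * blinfun_apply dp dq)"
    by (simp add: fun_eq_iff blinfun.add_left blinfun.add_right blinfun.scaleR_left
        blinfun.scaleR_right algebra_simps)
  then show ?thesis by (auto intro!: derivative_eq_intros)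
qed

lemma H_line_derivative:
  "((\<lambda>\<epsilon>::real. H (ham_args (z + \<epsilon> *\<^sub>R d))) has_real_derivative DH (ham_args z) (ham_args d)) (at 0)"
proof -
  interpret h: bounded_linear "ham_args :: ('q, 's, 'r) bdry \<Rightarrow> _" by (rule bounded_linear_ham_args)
  have "((\<lambda>\<epsilon>::real. ham_args (z + \<epsilon> *\<^sub>R d)) has_derivative (\<lambda>\<epsilon>. \<epsilon> *\<^sub>R ham_args d)) (at 0)"
  proof -
    have "((\<lambda>\<epsilon>::real. z + \<epsilon> *\<^sub>R d) has_derivative (\<lambda>\<epsilon>. \<epsilon> *\<^sub>R d)) (at 0)"
      by (auto intro!: derivative_eq_intros)
    from h.has_derivative[OF this] show ?thesis by (simp add: h.scaleR)
  qed
  moreover have "(H has_derivative DH (ham_args z)) (at (ham_args (z + (0::real) *\<^sub>R d)))"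
    using smooth_differentiable[OF smooth_H] by (simp add: frechet_derivative_works[symmetric])
  ultimately have "((\<lambda>\<epsilon>::real. H (ham_args (z + \<epsilon> *\<^sub>R d))) has_derivative
      (\<lambda>\<epsilon>. DH (ham_args z) (\<epsilon> *\<^sub>R ham_args d))) (at 0)"
    by (rule has_derivative_compose)
  moreover have "DH (ham_args z) (\<epsilon> *\<^sub>R ham_args d) = DH (ham_args z) (ham_args d) * \<epsilon>" for \<epsilon>
    using linear_cmul[OF bounded_linear.linear[OF smooth_bounded_linear_derivative[OF smooth_H]]] by simp
  ultimately show ?thesis by (simp add: has_field_derivative_def)
qed

lemma action_sum_has_derivative:
  fixes Z \<delta> :: "('q, 's, 'r) mesh_values"
  assumes NM: "N \<ge> 1" "M \<ge> 1" and Z: "shared_edges N M Z" and \<delta>: "admissible_variation N M \<delta>"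
  shows "((\<lambda>\<epsilon>. action_sum dt dx b b' H N M (\<lambda>m n. Z m n + \<epsilon> *\<^sub>R \<delta> m n)) has_real_derivative
    action_variation N M Z \<delta>) (at 0)"
proof -
  define X where "X m n = (\<Sum>i\<in>UNIV. dt * b i * (blinfun_apply (mom_x1 (Z m n) $ i) (phi_x1 (\<delta> m n) $ i) +
    blinfun_apply (mom_x1 (\<delta> m n) $ i) (phi_x1 (Z m n) $ i)))" for m n
  define T where "T m n = (\<Sum>\<alpha>\<in>UNIV. dx * b' \<alpha> * (blinfun_apply (mom_t1 (Z m n) $ \<alpha>) (phi_t1 (\<delta> m n) $ \<alpha>) +
    blinfun_apply (mom_t1 (\<delta> m n) $ \<alpha>) (phi_t1 (Z m n) $ \<alpha>)))" for m n
  define G where "G m n = DH (ham_args (Z m n)) (ham_args (\<delta> m n))" for m n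
  \<comment> \<open>\<open>X'\<close> differs from \<open>X\<close> only in the term with the varied
    field, which is moved from the \<open>x1\<close>-edge to the \<open>x0\<close>-edge;
    \<open>T'\<close> does the same in the \<open>t\<close> direction.\<close>
  define X' where "X' m n = (\<Sum>i\<in>UNIV. dt * b i * (blinfun_apply (mom_x0 (Z m n) $ i) (phi_x0 (\<delta> m n) $ i) +
    blinfun_apply (mom_x1 (\<delta> m n) $ i) (phi_x1 (Z m n) $ i)))" for m n
  define T' where "T' m n = (\<Sum>\<alpha>\<in>UNIV. dx * b' \<alpha> * (blinfun_apply (mom_t0 (Z m n) $ \<alpha>) (phi_t0 (\<delta> m n) $ \<alpha>) +
    blinfun_apply (mom_t1 (\<delta> m n) $ \<alpha>) (phi_t1 (Z m n) $ \<alpha>)))" for m n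
  have lin: "phi_x1 (z + \<epsilon> *\<^sub>R d) $ i = phi_x1 z $ i + \<epsilon> *\<^sub>R (phi_x1 d $ i)"
    "mom_x1 (z + \<epsilon> *\<^sub>R d) $ i = mom_x1 z $ i + \<epsilon> *\<^sub>R (mom_x1 d $ i)"
    "phi_t1 (z + \<epsilon> *\<^sub>R d) $ \<alpha> = phi_t1 z $ \<alpha> + \<epsilon> *\<^sub>R (phi_t1 d $ \<alpha>)"
    "mom_t1 (z + \<epsilon> *\<^sub>R d) $ \<alpha> = mom_t1 z $ \<alpha> + \<epsilon> *\<^sub>R (mom_t1 d $ \<alpha>)"
    for z d :: "('q, 's, 'r) bdry" and \<epsilon> i \<alpha>
    by (simp_all add: bdry_defs case_prod_beta)
  have deriv: "((\<lambda>\<epsilon>. action_sum dt dx b b' H N M (\<lambda>m n. Z m n + \<epsilon> *\<^sub>R \<delta> m n)) has_real_derivative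
    (\<Sum>m<N. X m (M - 1)) + (\<Sum>n<M. T (N - 1) n) - (\<Sum>m<N. \<Sum>n<M. X m n + T m n - G m n)) (at 0)"
    unfolding action_sum_def lin X_def T_def G_def
    by (intro DERIV_add DERIV_diff DERIV_sum DERIV_cmult pairing_derivative H_line_derivative)
  have x_edges: "(\<Sum>n<M. X m n) - X m (M - 1) = (\<Sum>n<M. X' m n)" if "m < N" for m
  proof -
    define a where "a n = (\<Sum>i\<in>UNIV. dt * b i * blinfun_apply (mom_x1 (Z m n) $ i) (phi_x1 (\<delta> m n) $ i))" for n
    define c where "c n = (\<Sum>i\<in>UNIV. dt * b i * blinfun_apply (mom_x0 (Z m n) $ i) (phi_x0 (\<delta> m n) $ i))" for n
    define d where "d n = (\<Sum>i\<in>UNIV. dt * b i * blinfun_apply (mom_x1 (\<delta> m n) $ i) (phi_x1 (Z m n) $ i))" for n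
    \<comment> \<open>Sharing is used for the momenta of \<open>Z\<close> and the fields of
      \<open>\<delta>\<close>. The end conditions are the vanishing of field variations on A(X) and
      of momentum variations on B(X).\<close>
    have "(\<Sum>n<M. a n + d n) - (a (M - 1) + d (M - 1)) = (\<Sum>n<M. c n + d n)"
      using Z \<delta> \<open>m < N\<close>
      by (intro sum_shift_edges NM)
        (simp_all add: shared_edges_def admissible_variation_def a_def c_def d_def)
    then show ?thesis
      by (simp add: X_def X'_def a_def c_def d_def distrib_left sum.distrib)
  qed
  have t_edges: "(\<Sum>m<N. T m n) - T (N - 1) n = (\<Sum>m<N. T' m n)" if "n < M" for n
  proof -
    define a where "a m = (\<Sum>\<alpha>\<in>UNIV. dx * b' \<alpha> * blinfun_apply (mom_t1 (Z m n) $ \<alpha>) (phi_t1 (\<delta> m n) $ \<alpha>))" for m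
    define c where "c m = (\<Sum>\<alpha>\<in>UNIV. dx * b' \<alpha> * blinfun_apply (mom_t0 (Z m n) $ \<alpha>) (phi_t0 (\<delta> m n) $ \<alpha>))" for m
    define d where "d m = (\<Sum>\<alpha>\<in>UNIV. dx * b' \<alpha> * blinfun_apply (mom_t1 (\<delta> m n) $ \<alpha>) (phi_t1 (Z m n) $ \<alpha>))" for m
    have "(\<Sum>m<N. a m + d m) - (a (N - 1) + d (N - 1)) = (\<Sum>m<N. c m + d m)"
      using Z \<delta> \<open>n < M\<close>
      by (intro sum_shift_edges NM)
        (simp_all add: shared_edges_def admissible_variation_def a_def c_def d_def)
    then show ?thesis
      by (simp add: T_def T'_def a_def c_def d_def distrib_left sum.distrib)
  qed
  have "(\<Sum>m<N. \<Sum>n<M. X m n) - (\<Sum>m<N. X m (M - 1)) = (\<Sum>m<N. \<Sum>n<M. X' m n)"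
    using x_edges by (simp add: sum_subtractf[symmetric])
  moreover have "(\<Sum>m<N. \<Sum>n<M. T m n) - (\<Sum>n<M. T (N - 1) n) = (\<Sum>m<N. \<Sum>n<M. T' m n)"
    using t_edges sum.swap[of T "{..<M}" "{..<N}"] sum.swap[of T' "{..<M}" "{..<N}"]
    by (simp add: sum_subtractf[symmetric])
  moreover have "action_variation N M Z \<delta> = (\<Sum>m<N. \<Sum>n<M. G m n - X' m n - T' m n)"
    unfolding action_variation_def G_def X'_def T'_def DH_split
    by (intro sum.cong refl)
      (simp add: blinfun.diff_left blinfun.diff_right blinfun.scaleR_left blinfun.scaleR_right
        sum_subtractf distrib_left sum.distrib)
  ultimately have "(\<Sum>m<N. X m (M - 1)) + (\<Sum>n<M. T (N - 1) n) - (\<Sum>m<N. \<Sum>n<M. X m n + T m n - G m n) =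
      action_variation N M Z \<delta>"
    by (simp add: sum_subtractf sum.distrib)
  then show ?thesis using deriv by simp
qed

text \<open>Variations are built from values on the edges: \<open>fx m n\<close> and \<open>px m n\<close> live on the \<open>x0\<close>-edge of the
  element \<open>(m, n)\<close>, \<open>ft m n\<close> and \<open>pt m n\<close> on its \<open>t0\<close>-edge. The sharing of edges is then automatic.\<close>

definition edge_variation :: "(nat \<Rightarrow> nat \<Rightarrow> 'q ^ 's) \<Rightarrow> (nat \<Rightarrow> nat \<Rightarrow> 'q ^ 'r) \<Rightarrow>
    (nat \<Rightarrow> nat \<Rightarrow> 'q dual ^ 's) \<Rightarrow> (nat \<Rightarrow> nat \<Rightarrow> 'q dual ^ 'r) \<Rightarrow> ('q, 's, 'r) mesh_values"
  where "edge_variation fx ft px pt m n =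
    (fx m n, fx m (Suc n), ft m n, ft (Suc m) n, px m n, px m (Suc n), pt m n, pt (Suc m) n)"

lemma edge_variation_admissible:
  assumes "N \<ge> 1" "M \<ge> 1" "\<And>m. fx m 0 = 0" "\<And>n. ft 0 n = 0" "\<And>m. px m M = 0" "\<And>n. pt N n = 0"
  shows "admissible_variation N M (edge_variation fx ft px pt)"
  using assms by (auto simp: admissible_variation_def shared_edges_def edge_variation_def bdry_defs)

lemma sum_single_edge:
  fixes g :: "nat \<Rightarrow> nat \<Rightarrow> 'i::finite \<Rightarrow> real"
  assumes "m0 < N" "n0 < M" "\<And>m n i. (m, n, i) \<noteq> (m0, n0, i0) \<Longrightarrow> g m n i = 0"
  shows "(\<Sum>m<N. \<Sum>n<M. \<Sum>i\<in>UNIV. g m n i) = g m0 n0 i0"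
proof -
  have "(\<Sum>m<N. \<Sum>n<M. \<Sum>i\<in>UNIV. g m n i) = (\<Sum>(m, n, i)\<in>{..<N} \<times> {..<M} \<times> UNIV. g m n i)"
    by (simp add: sum.cartesian_product)
  also have "\<dots> = (\<Sum>(m, n, i)\<in>{(m0, n0, i0)}. g m n i)"
    using assms by (intro sum.mono_neutral_right) auto
  finally show ?thesis by simp
qed

lemma action_variation_eq_0_imp_interior_equations:
  assumes NM: "N \<ge> 1" "M \<ge> 1"
    and Z: "\<And>\<delta>. admissible_variation N M \<delta> \<Longrightarrow> action_variation N M Z \<delta> = 0"
  shows "interior_equations dt dx b b' H N M Z"
proof -
  have "res_mom_x0 (Z m n) i = 0" if "m < N" "n < M" "n \<noteq> 0" for m n i
  proof (rule blinfun_eqI)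
    fix q :: 'q
    \<comment> \<open>A field bump on one \<open>x0\<close>-edge, off A(X) since
      \<open>n \<noteq> 0\<close>. The same edge is the \<open>x1\<close>-edge of the preceding
      element, but \<open>action_variation\<close> does not see fields there, so a single term
      survives.\<close>
    let ?f = "\<lambda>m' n'. if m' = m \<and> n' = n then axis i q else 0"
    have "0 = action_variation N M Z (edge_variation ?f (\<lambda>_ _. 0) (\<lambda>_ _. 0) (\<lambda>_ _. 0))"
      using that by (intro Z[symmetric] edge_variation_admissible NM) auto
    also have "\<dots> = (\<Sum>m'<N. \<Sum>n'<M. \<Sum>j\<in>UNIV. blinfun_apply (res_mom_x0 (Z m' n') j) (?f m' n' $ j))"
      by (simp add: action_variation_def edge_variation_def bdry_defs)
    also have "\<dots> = blinfun_apply (res_mom_x0 (Z m n) i) (?f m n $ i)"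
      using that by (intro sum_single_edge) (auto simp: axis_def)
    finally show "blinfun_apply (res_mom_x0 (Z m n) i) q = blinfun_apply 0 q" by simp
  qed
  moreover have "res_mom_t0 (Z m n) \<alpha> = 0" if "m < N" "n < M" "m \<noteq> 0" for m n \<alpha>
  proof (rule blinfun_eqI)
    fix q :: 'q
    let ?f = "\<lambda>m' n'. if m' = m \<and> n' = n then axis \<alpha> q else 0"
    have "0 = action_variation N M Z (edge_variation (\<lambda>_ _. 0) ?f (\<lambda>_ _. 0) (\<lambda>_ _. 0))"
      using that by (intro Z[symmetric] edge_variation_admissible NM) auto
    also have "\<dots> = (\<Sum>m'<N. \<Sum>n'<M. \<Sum>j\<in>UNIV. blinfun_apply (res_mom_t0 (Z m' n') j) (?f m' n' $ j))"
      by (simp add: action_variation_def edge_variation_def bdry_defs)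
    also have "\<dots> = blinfun_apply (res_mom_t0 (Z m n) \<alpha>) (?f m n $ \<alpha>)"
      using that by (intro sum_single_edge) (auto simp: axis_def)
    finally show "blinfun_apply (res_mom_t0 (Z m n) \<alpha>) q = blinfun_apply 0 q" by simp
  qed
  moreover have "res_phi_x1 (Z m n) i = 0" if "m < N" "n < M" "n \<noteq> M - 1" for m n i
  proof (rule dual_separates)
    fix p :: "'q dual"
    \<comment> \<open>The \<open>x1\<close>-edge of \<open>(m, n)\<close> is stored as the
      \<open>x0\<close>-edge of \<open>(m, Suc n)\<close>. As \<open>n \<noteq> M - 1\<close>, the
      index \<open>Suc n\<close> stays below \<open>M\<close> and the bump is off B(X).\<close>
    let ?f = "\<lambda>m' n'. if m' = m \<and> n' = Suc n then axis i p else 0"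
    have "0 = action_variation N M Z (edge_variation (\<lambda>_ _. 0) (\<lambda>_ _. 0) ?f (\<lambda>_ _. 0))"
      using that by (intro Z[symmetric] edge_variation_admissible NM) auto
    also have "\<dots> = (\<Sum>m'<N. \<Sum>n'<M. \<Sum>j\<in>UNIV. blinfun_apply (?f m' (Suc n') $ j) (res_phi_x1 (Z m' n') j))"
      by (simp add: action_variation_def edge_variation_def bdry_defs)
    also have "\<dots> = blinfun_apply (?f m (Suc n) $ i) (res_phi_x1 (Z m n) i)"
      using that by (intro sum_single_edge) (auto simp: axis_def)
    finally show "blinfun_apply p (res_phi_x1 (Z m n) i) = 0" by simp
  qed
  moreover have "res_phi_t1 (Z m n) \<alpha> = 0" if "m < N" "n < M" "m \<noteq> N - 1" for m n \<alpha>
  proof (rule dual_separates)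
    fix p :: "'q dual"
    let ?f = "\<lambda>m' n'. if m' = Suc m \<and> n' = n then axis \<alpha> p else 0"
    have "0 = action_variation N M Z (edge_variation (\<lambda>_ _. 0) (\<lambda>_ _. 0) (\<lambda>_ _. 0) ?f)"
      using that by (intro Z[symmetric] edge_variation_admissible NM) auto
    also have "\<dots> = (\<Sum>m'<N. \<Sum>n'<M. \<Sum>j\<in>UNIV. blinfun_apply (?f (Suc m') n' $ j) (res_phi_t1 (Z m' n') j))"
      by (simp add: action_variation_def edge_variation_def bdry_defs)
    also have "\<dots> = blinfun_apply (?f (Suc m) n $ \<alpha>) (res_phi_t1 (Z m n) \<alpha>)"
      using that by (intro sum_single_edge) (auto simp: axis_def)
    finally show "blinfun_apply p (res_phi_t1 (Z m n) \<alpha>) = 0" by simp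
  qed
  ultimately show ?thesis
    unfolding interior_equations_def residual_eq_iff by blast
qed

text \<open>In each pairing one factor is zero: the variation on A(X) or B(X), the residual on every
  other edge.\<close>

lemma action_variation_eq_0:
  assumes int: "interior_equations dt dx b b' H N M Z" and \<delta>: "admissible_variation N M \<delta>"
  shows "action_variation N M Z \<delta> = 0"
  unfolding action_variation_def
proof (intro sum.neutral ballI)
  fix m n assume mn: "m \<in> {..<N}" "n \<in> {..<M}"
  have "blinfun_apply (res_mom_x0 (Z m n) i) (phi_x0 (\<delta> m n) $ i) = 0" for i
    using int \<delta> mn unfolding interior_equations_def admissible_variation_def residual_eq_iff
    by (cases "n = 0") auto
  moreover have "blinfun_apply (res_mom_t0 (Z m n) \<alpha>) (phi_t0 (\<delta> m n) $ \<alpha>) = 0" for \<alpha>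
    using int \<delta> mn unfolding interior_equations_def admissible_variation_def residual_eq_iff
    by (cases "m = 0") auto
  moreover have "blinfun_apply (mom_x1 (\<delta> m n) $ i) (res_phi_x1 (Z m n) i) = 0" for i
    using int \<delta> mn unfolding interior_equations_def admissible_variation_def residual_eq_iff
    by (cases "n = M - 1") auto
  moreover have "blinfun_apply (mom_t1 (\<delta> m n) $ \<alpha>) (res_phi_t1 (Z m n) \<alpha>) = 0" for \<alpha>
    using int \<delta> mn unfolding interior_equations_def admissible_variation_def residual_eq_iff
    by (cases "m = N - 1") auto
  ultimately show "(\<Sum>i\<in>UNIV. blinfun_apply (res_mom_x0 (Z m n) i) (phi_x0 (\<delta> m n) $ i)) +
    (\<Sum>\<alpha>\<in>UNIV. blinfun_apply (res_mom_t0 (Z m n) \<alpha>) (phi_t0 (\<delta> m n) $ \<alpha>)) +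
    (\<Sum>i\<in>UNIV. blinfun_apply (mom_x1 (\<delta> m n) $ i) (res_phi_x1 (Z m n) i)) +
    (\<Sum>\<alpha>\<in>UNIV. blinfun_apply (mom_t1 (\<delta> m n) $ \<alpha>) (res_phi_t1 (Z m n) \<alpha>)) = 0"
    by (simp only: sum.neutral_const add_0)
qed

lemma type_II_stationary_iff:
  assumes "N \<ge> 1" "M \<ge> 1" "shared_edges N M Z"
  shows "type_II_stationary dt dx b b' H N M Z \<longleftrightarrow> interior_equations dt dx b b' H N M Z"
proof
  assume st: "type_II_stationary dt dx b b' H N M Z"
  have "action_variation N M Z \<delta> = 0" if \<delta>: "admissible_variation N M \<delta>" for \<delta>
    using st \<delta> unfolding type_II_stationary_def
    by (intro DERIV_unique[OF action_sum_has_derivative[OF assms \<delta>]]) blast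
  then show "interior_equations dt dx b b' H N M Z"
    by (rule action_variation_eq_0_imp_interior_equations[OF assms(1,2)])
next
  assume int: "interior_equations dt dx b b' H N M Z"
  show "type_II_stationary dt dx b b' H N M Z"
    unfolding type_II_stationary_def
    using action_sum_has_derivative[OF assms] action_variation_eq_0[OF int] by fastforce
qed

end

text \<open>The cases left out by the index conditions of the interior equations are exactly those
  listed in the boundary equations.\<close>

lemma forward_hamilton_mesh_iff:
  assumes "N \<ge> 1" "M \<ge> 1"
  shows "(\<forall>m<N. \<forall>n<M. forward_hamilton dt dx b b' H (Z m n)) \<longleftrightarrow>
    interior_equations dt dx b b' H N M Z \<and> boundary_equations dt dx b b' H N M Z"
proof (intro iffI conjI)
  assume "\<forall>m<N. \<forall>n<M. forward_hamilton dt dx b b' H (Z m n)"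
  then show "interior_equations dt dx b b' H N M Z" "boundary_equations dt dx b b' H N M Z"
    using assms by (auto simp: forward_hamilton_def interior_equations_def boundary_equations_def)
next
  assume *: "interior_equations dt dx b b' H N M Z \<and> boundary_equations dt dx b b' H N M Z"
  show "\<forall>m<N. \<forall>n<M. forward_hamilton dt dx b b' H (Z m n)"
  proof (intro allI impI)
    fix m n assume mn: "m < N" "n < M"
    have "eq_mom_x0 dt b H (Z m n)"
      using * mn by (cases "n = 0") (simp_all add: interior_equations_def boundary_equations_def)
    moreover have "eq_mom_t0 dx b' H (Z m n)"
      using * mn by (cases "m = 0") (simp_all add: interior_equations_def boundary_equations_def)
    moreover have "eq_phi_x1 dt b H (Z m n)"
      using * mn by (cases "n = M - 1") (simp_all add: interior_equations_def boundary_equations_def)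
    moreover have "eq_phi_t1 dx b' H (Z m n)"
      using * mn by (cases "m = N - 1") (simp_all add: interior_equations_def boundary_equations_def)
    ultimately show "forward_hamilton dt dx b b' H (Z m n)"
      by (simp add: forward_hamilton_def)
  qed
qed

theorem proposition2p3:
  fixes B :: "'q::real_normed_vector set"
    and dt dx :: real
    and c b :: "'s::finite \<Rightarrow> real"
    and c' b' :: "'r::finite \<Rightarrow> real"
    and H :: "('q, 's, 'r) ham_arg \<Rightarrow> real"
  assumes "finite B" and "independent B" and "span B = UNIV"
    and "dt > 0" and "dx > 0"
    and "quadrature_rule c b" and "quadrature_rule c' b'"
    and "smooth H"
  shows "(\<forall>N M Z. N \<ge> 1 \<and> M \<ge> 1 \<and> shared_edges N M Z \<longrightarrow>
           (type_II_stationary dt dx b b' H N M Z \<longleftrightarrow> interior_equations dt dx b b' H N M Z) \<and>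
           (boundary_equations dt dx b b' H N M Z \<longrightarrow>
             (type_II_stationary dt dx b b' H N M Z \<longleftrightarrow>
               (\<forall>m<N. \<forall>n<M. forward_hamilton dt dx b b' H (Z m n))))) \<and>
         (\<forall>z V W. forward_hamilton dt dx b b' H z \<and>
           first_variation dt dx b b' H z V \<and> first_variation dt dx b b' H z W \<longrightarrow>
           multisymplectic_form B dt dx b b' z V W = 0)"
proof -
  interpret boundary_hamiltonian B dt dx b b' H
    by unfold_locales (use assms in \<open>simp_all add: quadrature_rule_def\<close>)
  show ?thesis
    using type_II_stationary_iff forward_hamilton_mesh_iff[of _ _ dt dx b b' H] multisymplectic_form_eq_0
    by (intro conjI allI impI; elim conjE) simp_all
qed

end
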